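(* Let each of $n$ users hold a one-hot vector $X_i\in\{e_1,\dots,e_d\}\subset\{0,1\}^d$, in the regime $d\gg n$. To compute the histogram $\mu(X^n)=\sum_{i=1}^nX_i$ from the $n$ users securely (i.e. under (S1) and (S2)) and correctly (i.e. under (C1)), it is both sufficient and necessary for each user to send $\Theta(n\log d)$ bits to the server.
   Context: $[n]=\{1,\dots,n\}$; $e_1,\dots,e_d$ are the standard basis vectors; $H(\cdot)$ is Shannon entropy (base 2); $I(\cdot;\cdot)$ and $I(\cdot;\cdot\mid\cdot)$ are (conditional) mutual information; $X_A=(X_i)_{i\in A}$ and $\mu(X_A)=\sum_{i\in A}X_i$ for $A\subseteq[n]$; $X^n=X_{[n]}$. Aggregation protocol. There are a single server and $n$ users. User $i$ encodes $X_i$ as $Y_i=g_i(X_i;\theta_i)$, where $g_i$ is an encoding function and $\theta_i$ is randomness available at user $i$, independent of $X_i$ but possibly dependent on the other $\theta_{i'}$, $i'\in[n]\setminus\{i\}$. Up to $D$ users may drop out. If the set of dropouts is $\mathcal{D}$, the server observes $Y_{[n]\setminus\mathcal{D}}$. If $\mathcal{D}=\emptyset$, it estimates the sum by a deterministic function $f(Y^n)$. If $\mathcal{D}\ne\emptyset$, the server in a second round of communication collects $h(\theta_{[n]},\mathcal{D})$, where $h$ is a general function of the local secrets $\theta_{[n]}$, and estimates $\mu(X_{[n]\setminus\mathcal{D}})$ by $f(Y_{[n]\setminus\mathcal{D}},h(\theta_{[n]},\mathcal{D}))$. The result is presented for the case where no user actually drops out ($\mathcal D=\emptyset$). Security constraints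 with dropout tolerance $D$ (a number, not to be confused with the set $\mathcal D$), required for every distribution $P_{X^n}$ of the user data: (S1) for all $\mathcal{D}\subseteq[n]$: $I\big(Y_{[n]\setminus\mathcal{D}},h(\theta_{[n]},\mathcal{D});X_{[n]\setminus\mathcal{D}}\,\big|\,\mu(X_{[n]\setminus\mathcal{D}})\big)=0$; (S2) for all $\mathcal{D}$ with $|\mathcal{D}|>D$: $I\big(Y_{[n]\setminus\mathcal{D}},h(\theta_{[n]},\mathcal{D});X_{[n]\setminus\mathcal{D}}\big)=0$. Correctness constraint: (C1) for all $\mathcal{D}$ with $|\mathcal{D}|\le D$: $\Pr\{f(Y_{[n]\setminus\mathcal{D}},h(\theta_{[n]},\mathcal{D}))=\mu(X_{[n]\setminus\mathcal{D}})\}=1$. The number of bits user $i$ sends (its communication cost) is measured by $\max_{P_{X^n}}H(Y_i)$, the maximum being over all joint distributions of the user data.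
   Formalization: The regime d ≫ n is made precise as d ≥ n^(1+ε) for an arbitrary fixed ε > 0, with Θ-constants depending only on ε; under the weaker reading d/n → ∞ (e.g. d = n log n) the claim fails, since O(n log(d/n)) bits suffice. *)

theory Defs
  imports "HOL-Probability.Probability"
begin

text \<open>
  A vector of \<open>{0,1}\<^sup>d\<close> or of the histogram space is a function \<open>nat \<Rightarrow> nat\<close> with coordinates
  \<open>1, \<dots>, d\<close>, and zero elsewhere. User data, encodings and secrets are families indexed by the
  users \<open>1, \<dots>, n\<close>; the subfamily belonging to a set \<open>A\<close> of users is \<open>restrict _ A\<close>.
\<close>

definition unit_vector :: "nat \<Rightarrow> nat \<Rightarrow> nat" where
  "unit_vector j = (\<lambda>k. if k = j then 1 else 0)"

definition one_hot :: "nat \<Rightarrow> (nat \<Rightarrow> nat) set" where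
  "one_hot d = unit_vector ` {1..d}"

definition aggregate :: "nat set \<Rightarrow> (nat \<Rightarrow> nat \<Rightarrow> nat) \<Rightarrow> nat \<Rightarrow> nat" where
  "aggregate A x = (\<lambda>k. \<Sum>i\<in>A. x i k)"

abbreviation user_data :: "nat \<Rightarrow> nat set \<Rightarrow> (nat \<Rightarrow> nat \<Rightarrow> nat) set" where
  "user_data d A \<equiv> A \<rightarrow>\<^sub>E one_hot d"

text \<open>All joint distributions \<open>P\<close> of the user data; users may be arbitrarily correlated.\<close>

definition data_laws :: "nat \<Rightarrow> nat \<Rightarrow> (nat \<Rightarrow> nat \<Rightarrow> nat) measure set" where
  "data_laws n d = space (prob_algebra (count_space (user_data d {1..n})))"

text \<open>
  The secrets \<open>\<theta>\<^sub>1, \<dots>, \<theta>\<^sub>n\<close> are real random variables with an arbitrary joint law, so each may carry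
  any standard Borel (in particular any discrete) randomness. Messages \<open>Y\<^sub>i\<close> range over a countable
  alphabet, coded by \<open>nat\<close>. The second-round message \<open>h(\<theta>, \<D>)\<close> is again a real number.
  The decoder \<open>f\<close> knows which users dropped out, as the server does.
\<close>

record protocol =
  secrets :: "(nat \<Rightarrow> real) measure"
  enc :: "nat \<Rightarrow> (nat \<Rightarrow> nat) \<Rightarrow> real \<Rightarrow> nat"
  reveal :: "nat set \<Rightarrow> (nat \<Rightarrow> real) \<Rightarrow> real"
  dec :: "nat set \<Rightarrow> (nat \<Rightarrow> nat) \<times> real \<Rightarrow> (nat \<Rightarrow> nat)"

definition aggregation_protocol :: "nat \<Rightarrow> nat \<Rightarrow> protocol \<Rightarrow> bool" where
  "aggregation_protocol n d \<pi> \<longleftrightarrow>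
     secrets \<pi> \<in> space (prob_algebra (Pi\<^sub>M {1..n} (\<lambda>_. borel))) \<and>
     (\<forall>i\<in>{1..n}. \<forall>v\<in>one_hot d. enc \<pi> i v \<in> borel \<rightarrow>\<^sub>M count_space UNIV) \<and>
     (\<forall>S\<subseteq>{1..n}. reveal \<pi> S \<in> Pi\<^sub>M {1..n} (\<lambda>_. borel) \<rightarrow>\<^sub>M borel)"

text \<open>The probability space of pairs \<open>(x, \<theta>)\<close>: the secrets are independent of the user data.\<close>

definition joint_law :: "protocol \<Rightarrow> (nat \<Rightarrow> nat \<Rightarrow> nat) measure
    \<Rightarrow> ((nat \<Rightarrow> nat \<Rightarrow> nat) \<times> (nat \<Rightarrow> real)) measure" where
  "joint_law \<pi> P = P \<Otimes>\<^sub>M secrets \<pi>"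

definition message :: "protocol \<Rightarrow> nat \<Rightarrow> (nat \<Rightarrow> nat \<Rightarrow> nat) \<times> (nat \<Rightarrow> real) \<Rightarrow> nat" where
  "message \<pi> i = (\<lambda>(x, \<theta>). enc \<pi> i (x i) (\<theta> i))"

text \<open>
  What the server sees when \<open>S\<close> is the set of dropouts. There is no second round when \<open>S = {}\<close>;
  the second component then is the constant \<open>0\<close>.
\<close>

definition view :: "nat \<Rightarrow> protocol \<Rightarrow> nat set
    \<Rightarrow> (nat \<Rightarrow> nat \<Rightarrow> nat) \<times> (nat \<Rightarrow> real) \<Rightarrow> (nat \<Rightarrow> nat) \<times> real" where
  "view n \<pi> S = (\<lambda>\<omega>. (\<lambda>i\<in>{1..n} - S. message \<pi> i \<omega>,
                       if S = {} then 0 else reveal \<pi> S (snd \<omega>)))"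

abbreviation view_space :: "nat \<Rightarrow> nat set \<Rightarrow> ((nat \<Rightarrow> nat) \<times> real) measure" where
  "view_space n S \<equiv> Pi\<^sub>M ({1..n} - S) (\<lambda>_. count_space UNIV) \<Otimes>\<^sub>M borel"

abbreviation surviving_data :: "nat \<Rightarrow> nat set
    \<Rightarrow> (nat \<Rightarrow> nat \<Rightarrow> nat) \<times> (nat \<Rightarrow> real) \<Rightarrow> (nat \<Rightarrow> nat \<Rightarrow> nat)" where
  "surviving_data n S \<equiv> \<lambda>\<omega>. restrict (fst \<omega>) ({1..n} - S)"

abbreviation surviving_sum :: "nat \<Rightarrow> nat set
    \<Rightarrow> (nat \<Rightarrow> nat \<Rightarrow> nat) \<times> (nat \<Rightarrow> real) \<Rightarrow> (nat \<Rightarrow> nat)" where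
  "surviving_sum n S \<equiv> \<lambda>\<omega>. aggregate ({1..n} - S) (fst \<omega>)"

text \<open>
  In both security constraints the data take finitely many values, so the mutual informations below
  are finite and the integrals defining them exist, even if the view has a continuous law.
\<close>

definition secure_given_sum :: "nat \<Rightarrow> nat \<Rightarrow> protocol \<Rightarrow> bool" where
  "secure_given_sum n d \<pi> \<longleftrightarrow> (\<forall>P\<in>data_laws n d. \<forall>S\<subseteq>{1..n}.
     prob_space.conditional_mutual_information (joint_law \<pi> P) 2
       (view_space n S) (count_space (user_data d ({1..n} - S))) (count_space UNIV)
       (view n \<pi> S) (surviving_data n S) (surviving_sum n S) = 0)"

definition secure_beyond_tolerance :: "nat \<Rightarrow> nat \<Rightarrow> nat \<Rightarrow> protocol \<Rightarrow> bool" where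
  "secure_beyond_tolerance n d D \<pi> \<longleftrightarrow> (\<forall>P\<in>data_laws n d. \<forall>S\<subseteq>{1..n}. card S > D \<longrightarrow>
     prob_space.mutual_information (joint_law \<pi> P) 2
       (view_space n S) (count_space (user_data d ({1..n} - S)))
       (view n \<pi> S) (surviving_data n S) = 0)"

definition correct :: "nat \<Rightarrow> nat \<Rightarrow> nat \<Rightarrow> protocol \<Rightarrow> bool" where
  "correct n d D \<pi> \<longleftrightarrow> (\<forall>P\<in>data_laws n d. \<forall>S\<subseteq>{1..n}. card S \<le> D \<longrightarrow>
     (AE \<omega> in joint_law \<pi> P. dec \<pi> S (view n \<pi> S \<omega>) = surviving_sum n S \<omega>))"

definition secure_histogram_protocol :: "nat \<Rightarrow> nat \<Rightarrow> nat \<Rightarrow> protocol \<Rightarrow> bool" where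
  "secure_histogram_protocol n d D \<pi> \<longleftrightarrow> aggregation_protocol n d \<pi> \<and>
     secure_given_sum n d \<pi> \<and> secure_beyond_tolerance n d D \<pi> \<and> correct n d D \<pi>"

text \<open>
  Shannon entropy in bits of a discrete random variable. The library's \<open>entropy\<close> is a Bochner
  integral and would give \<open>0\<close> for a variable of infinite entropy; the sum below gives \<open>\<infinity>\<close>.
  For finitely many values the two agree (lemma \<open>entropy_bits_simple\<close>).
\<close>

definition entropy_bits :: "'w measure \<Rightarrow> ('w \<Rightarrow> nat) \<Rightarrow> ennreal" where
  "entropy_bits M Y =
     (\<Sum>y. ennreal (- (measure M (Y -` {y} \<inter> space M) * log 2 (measure M (Y -` {y} \<inter> space M)))))"

definition communication_cost :: "nat \<Rightarrow> nat \<Rightarrow> protocol \<Rightarrow> nat \<Rightarrow> ennreal" where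
  "communication_cost n d \<pi> i =
     (SUP P\<in>data_laws n d. entropy_bits (joint_law \<pi> P) (message \<pi> i))"

lemma (in prob_space) entropy_bits_simple:
  assumes Y: "simple_function M Y"
  shows "entropy_bits M Y = ennreal (entropy 2 (count_space (Y ` space M)) Y)"
proof -
  interpret information_space M 2 by standard simp
  let ?p = "\<lambda>y. measure M (Y -` {y} \<inter> space M)"
  have fin: "finite (Y ` space M)" using Y by (rule simple_functionD)
  have nn: "0 \<le> - (?p y * log 2 (?p y))" for y
  proof (cases "?p y = 0")
    case False
    then have "0 < ?p y" by (simp add: zero_less_measure_iff)
    then have "log 2 (?p y) \<le> 0" by simp
    then show ?thesis by (simp add: mult_nonneg_nonpos)
  qed simp
  have "entropy 2 (count_space (Y ` space M)) Y = - (\<Sum>y\<in>Y ` space M. ?p y * log 2 (?p y))"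
    by (rule entropy_simple_distributed, rule simple_distributedI[OF Y]) auto
  moreover have "entropy_bits M Y = (\<Sum>y\<in>Y ` space M. ennreal (- (?p y * log 2 (?p y))))"
    unfolding entropy_bits_def
  proof (rule suminf_finite[OF fin])
    fix y assume "y \<notin> Y ` space M"
    then have "Y -` {y} \<inter> space M = {}" by auto
    then show "ennreal (- (?p y * log 2 (?p y))) = 0" by (simp only: measure_empty) simp
  qed
  ultimately show ?thesis
    using nn by (simp add: sum_ennreal sum_negf)
qed

lemma finite_user_data: "finite A \<Longrightarrow> finite (user_data d A)"
  by (simp add: one_hot_def finite_PiE)

lemma message_measurable:
  assumes \<pi>: "aggregation_protocol n d \<pi>" and P: "P \<in> data_laws n d" and i: "i \<in> {1..n}"
  shows "message \<pi> i \<in> joint_law \<pi> P \<rightarrow>\<^sub>M count_space UNIV"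
proof -
  have sP: "sets P = sets (count_space (user_data d {1..n}))"
    and sS: "sets (secrets \<pi>) = sets (Pi\<^sub>M {1..n} (\<lambda>_. borel))"
    using \<pi> P by (auto simp: data_laws_def aggregation_protocol_def space_prob_algebra)
  have "(\<lambda>(x, \<theta>). enc \<pi> i (x i) (\<theta> i)) \<in>
      count_space (user_data d {1..n}) \<Otimes>\<^sub>M Pi\<^sub>M {1..n} (\<lambda>_. borel) \<rightarrow>\<^sub>M count_space UNIV"
  proof (rule measurable_pair_measure_countable1)
    show "countable (user_data d {1..n})" by (simp add: finite_user_data countable_finite)
    fix x assume "x \<in> user_data d {1..n}"
    then have "x i \<in> one_hot d" using i by auto
    then have "enc \<pi> i (x i) \<in> borel \<rightarrow>\<^sub>M count_space UNIV"
      using \<pi> i by (auto simp: aggregation_protocol_def)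
    from measurable_compose[OF measurable_component_singleton[OF i] this]
    show "(\<lambda>\<theta>. case (x, \<theta>) of (x, \<theta>) \<Rightarrow> enc \<pi> i (x i) (\<theta> i))
        \<in> Pi\<^sub>M {1..n} (\<lambda>_. borel) \<rightarrow>\<^sub>M count_space UNIV" by simp
  qed
  then show ?thesis
    unfolding message_def joint_law_def
    by (simp add: measurable_cong_sets[OF sets_pair_measure_cong[OF sP sS] refl])
qed

lemma view_measurable:
  assumes \<pi>: "aggregation_protocol n d \<pi>" and P: "P \<in> data_laws n d" and S: "S \<subseteq> {1..n}"
  shows "view n \<pi> S \<in> joint_law \<pi> P \<rightarrow>\<^sub>M view_space n S"
proof -
  have "sets (secrets \<pi>) = sets (Pi\<^sub>M {1..n} (\<lambda>_. borel))"
    using \<pi> by (auto simp: aggregation_protocol_def space_prob_algebra)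
  then have "reveal \<pi> S \<in> secrets \<pi> \<rightarrow>\<^sub>M borel"
    using \<pi> S by (auto simp: aggregation_protocol_def cong: measurable_cong_sets)
  then have "(\<lambda>\<omega>. reveal \<pi> S (snd \<omega>)) \<in> joint_law \<pi> P \<rightarrow>\<^sub>M borel"
    unfolding joint_law_def by measurable
  then show ?thesis
    unfolding view_def using message_measurable[OF \<pi> P]
    by (auto intro!: measurable_Pair measurable_restrict)
qed

end

theory Submission
  imports Defs
begin

text \<open>
  Sufficiency: choose integer weights at random so that the linear form they define is injective on
  all histograms; by a union bound weights of \<open>O(n log d)\<close> bits suffice. Each user sends its weight
  plus a mask modulo \<open>m\<close>, where the masks are uniform subject to having sum zero, and after dropouts
  the sum of the surviving masks is revealed. Two data vectors with the same sum are exchanged by a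
  translation of the masks that leaves the view unchanged, which gives the security constraints.

  Necessity: without dropouts, (S1) says that the law of all messages given the data depends only on
  the sum of the data. Exchanging coordinates with user \<open>i\<close>, the law of the other users' messages
  does not depend on the data at all. For a fixed datum of user \<open>i\<close>, correctness forces the message
  \<open>y\<close> of user \<open>i\<close> to be completed, for each possible sum of the others, inside one of pairwise
  disjoint events of the other messages. Hence \<open>y\<close> has probability at most \<open>1 / K\<close>, where \<open>K\<close> is
  the number of these sums, and the entropy is at least \<open>log K\<close>, which is of order \<open>n log d\<close>.
\<close>

section \<open>Mutual information of an observation of finite data\<close>

lemma (in prob_space) KL_divergence_eq_0_imp_eq:
  fixes c :: real
  assumes N: "prob_space N" "sets N = sets M" and "1 < b" and "0 \<le> c"
    and le: "\<And>E. E \<in> sets M \<Longrightarrow> emeasure N E \<le> ennreal c * emeasure M E"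
    and KL: "KL_divergence b M N = 0"
  shows "N = M"
proof -
  interpret N: prob_space N by fact
  interpret information_space M b by standard fact
  have ac: "absolutely_continuous M N"
    unfolding absolutely_continuous_def null_sets_def using le N(2) by fastforce
  obtain D where D: "D \<in> borel_measurable M" "AE x in M. RN_deriv M N x = ennreal (D x)"
      "\<And>x. 0 \<le> D x"
    using real_RN_deriv[OF N.finite_measure_axioms ac N(2)] by this auto
  note D(1)[measurable]
  have "N = density M (RN_deriv M N)"
    using ac N(2) by (rule density_RN_deriv[symmetric])
  also have "\<dots> = density M D"
    using D by (auto intro!: density_cong)
  finally have N_eq: "N = density M D" .
  define E where "E = {x \<in> space M. c < D x}"
  have E[measurable]: "E \<in> sets M" unfolding E_def by measurable
  have "(\<integral>\<^sup>+x. ennreal (D x - c) * indicator E x \<partial>M) + ennreal c * emeasure M E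
      = (\<integral>\<^sup>+x. ennreal (D x - c) * indicator E x + ennreal c * indicator E x \<partial>M)"
    by (subst nn_integral_add) (auto simp: nn_integral_cmult_indicator)
  also have "\<dots> = (\<integral>\<^sup>+x. ennreal (D x) * indicator E x \<partial>M)"
    using \<open>0 \<le> c\<close> D(3) by (intro nn_integral_cong)
      (auto simp: indicator_def E_def ennreal_plus[symmetric] simp del: ennreal_plus)
  also have "\<dots> = emeasure N E"
    unfolding N_eq by (simp add: emeasure_density)
  also have "\<dots> \<le> 0 + ennreal c * emeasure M E"
    using le[OF E] by simp
  finally have "(\<integral>\<^sup>+x. ennreal (D x - c) * indicator E x \<partial>M) \<le> 0"
    using ennreal_add_left_cancel_le[of "ennreal c * emeasure M E" _ 0]
    by (simp add: add.commute ennreal_mult_eq_top_iff emeasure_eq_measure)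
  then have "AE x in M. ennreal (D x - c) * indicator E x = 0"
    by (subst (asm) le_zero_eq, subst (asm) nn_integral_0_iff_AE) auto
  then have D_le: "AE x in M. D x \<le> c"
    using AE_space by eventually_elim (auto simp: E_def indicator_def ennreal_eq_0_iff split: if_splits)
  have bound: "\<bar>t * log b t\<bar> \<le> (1 + c * c) / ln b" if "0 \<le> t" "t \<le> c" for t
  proof -
    have "t * ln t \<le> c * c" if "0 < t"
    proof -
      have "ln t \<le> t" using ln_le_minus_one[OF that] by simp
      then have "t * ln t \<le> t * t" using that by (intro mult_left_mono) auto
      also have "\<dots> \<le> c * c" using that \<open>t \<le> c\<close> by (intro mult_mono) auto
      finally show ?thesis .
    qed
    moreover have "- (t * ln t) \<le> 1" if "0 < t"
    proof -
      have "ln (1 / t) \<le> 1 / t - 1" using that by (intro ln_le_minus_one) auto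
      then have "t * ln (1 / t) \<le> t * (1 / t - 1)" using that by (intro mult_left_mono) auto
      also have "\<dots> \<le> 1" using that by (simp add: field_simps)
      finally show ?thesis using that by (simp add: ln_div)
    qed
    ultimately have "\<bar>t * ln t\<bar> \<le> 1 + c * c"
      using that(1) by (cases "t = 0") (auto simp: abs_le_iff intro: add_increasing add_increasing2)
    then show ?thesis
      using \<open>1 < b\<close> by (simp add: log_def abs_mult divide_right_mono)
  qed
  have int: "integrable M (\<lambda>x. D x * log b (D x))"
    by (rule integrable_const_bound[where B = "(1 + c * c) / ln b"])
      (use D_le bound D(3) in \<open>auto elim!: eventually_mono\<close>)
  show ?thesis
    using KL_eq_0_iff_eq[of D] N(1) D(3) int KL unfolding N_eq by auto
qed

text \<open>
  Data \<open>x\<close> with law \<open>P\<close> on a finite set \<open>A\<close>, independent randomness with law \<open>Q\<close>, and an observation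
  \<open>V\<close> of both.
\<close>

locale finite_channel = P: prob_space P + Q: prob_space Q
  for P :: "'x measure" and Q :: "'t measure" +
  fixes A :: "'x set" and MV :: "'v measure" and V :: "'x \<times> 't \<Rightarrow> 'v"
  assumes finite_A: "finite A"
    and sets_P: "sets P = Pow A"
    and V[measurable]: "V \<in> P \<Otimes>\<^sub>M Q \<rightarrow>\<^sub>M MV"
begin

sublocale J: pair_prob_space P Q ..

definition kernel :: "'x \<Rightarrow> 'v measure" where
  "kernel x = distr Q MV (\<lambda>\<theta>. V (x, \<theta>))"

definition marginal :: "'v measure" where
  "marginal = distr (P \<Otimes>\<^sub>M Q) MV V"

lemma space_P: "space P = A"
  using sets_P by (metis Pow_top sets.top sets.sets_into_space Pow_iff subset_antisym)

lemma measurable_P: "f \<in> A \<rightarrow> space N \<Longrightarrow> f \<in> P \<rightarrow>\<^sub>M N"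
  by (auto simp: measurable_def space_P sets_P)

lemma V_Pair: "x \<in> A \<Longrightarrow> (\<lambda>\<theta>. V (x, \<theta>)) \<in> Q \<rightarrow>\<^sub>M MV"
  by (rule measurable_compose[OF measurable_Pair1' V]) (simp add: space_P)

lemma sets_kernel[simp, measurable_cong]: "sets (kernel x) = sets MV"
  and space_kernel[simp]: "space (kernel x) = space MV"
  and sets_marginal[simp, measurable_cong]: "sets marginal = sets MV"
  and space_marginal[simp]: "space marginal = space MV"
  by (simp_all add: kernel_def marginal_def)

lemma prob_space_kernel: "x \<in> A \<Longrightarrow> prob_space (kernel x)"
  unfolding kernel_def by (rule Q.prob_space_distr) (rule V_Pair)

sublocale marginal: prob_space marginal
  unfolding marginal_def by (rule J.prob_space_distr) simp

lemma AE_P: "AE x in P. x \<in> A \<and> emeasure P {x} \<noteq> 0"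
proof -
  have "emeasure P {x \<in> A. emeasure P {x} = 0} = (\<Sum>x\<in>{x \<in> A. emeasure P {x} = 0}. emeasure P {x})"
    by (rule emeasure_eq_sum_singleton) (use finite_A sets_P in auto)
  then have "{x \<in> A. emeasure P {x} = 0} \<in> null_sets P"
    by (auto simp: null_sets_def sets_P)
  then show ?thesis
    by (rule AE_I') (auto simp: space_P)
qed

lemma emeasure_joint:
  assumes W: "W \<in> A \<rightarrow> space MW" and E: "E \<in> sets (MV \<Otimes>\<^sub>M MW)"
  shows "emeasure (distr (P \<Otimes>\<^sub>M Q) (MV \<Otimes>\<^sub>M MW) (\<lambda>\<omega>. (V \<omega>, W (fst \<omega>)))) E
    = (\<integral>\<^sup>+x. emeasure (kernel x) {v \<in> space MV. (v, W x) \<in> E} \<partial>P)"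
proof -
  have [measurable]: "W \<in> P \<rightarrow>\<^sub>M MW" using W by (rule measurable_P)
  have [measurable]: "E \<in> sets (MV \<Otimes>\<^sub>M MW)" by fact
  show ?thesis
    apply (subst emeasure_distr)
      apply measurable
    apply (subst Q.emeasure_pair_measure_alt)
     apply measurable
    apply (rule nn_integral_cong)
    apply (unfold kernel_def)
    apply (subst emeasure_distr)
      apply (simp add: space_P V_Pair)
    subgoal for x
      using W by (measurable, auto simp: space_P)
    apply (rule arg_cong2[where f = emeasure, OF refl])
    using measurable_space[OF V]
    by (auto simp: space_pair_measure space_P)
qed

lemma distr_data:
  assumes W: "W \<in> A \<rightarrow> space MW"
  shows "distr (P \<Otimes>\<^sub>M Q) MW (\<lambda>\<omega>. W (fst \<omega>)) = distr P MW W"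
proof (rule measure_eqI)
  fix E assume "E \<in> sets (distr (P \<Otimes>\<^sub>M Q) MW (\<lambda>\<omega>. W (fst \<omega>)))"
  then have [measurable]: "E \<in> sets MW" by simp
  have [measurable]: "W \<in> P \<rightarrow>\<^sub>M MW" using W by (rule measurable_P)
  have eq: "(\<lambda>\<omega>. W (fst \<omega>)) -` E \<inter> space (P \<Otimes>\<^sub>M Q) = (W -` E \<inter> space P) \<times> space Q"
    by (auto simp: space_pair_measure)
  show "emeasure (distr (P \<Otimes>\<^sub>M Q) MW (\<lambda>\<omega>. W (fst \<omega>))) E = emeasure (distr P MW W) E"
    by (simp add: emeasure_distr eq Q.emeasure_pair_measure_Times Q.emeasure_space_1)
qed simp

lemma emeasure_product:
  assumes W: "W \<in> A \<rightarrow> space MW" and E: "E \<in> sets (MV \<Otimes>\<^sub>M MW)"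
  shows "emeasure (marginal \<Otimes>\<^sub>M distr P MW W) E
    = (\<integral>\<^sup>+x. emeasure marginal {v \<in> space MV. (v, W x) \<in> E} \<partial>P)"
proof -
  have [measurable]: "W \<in> P \<rightarrow>\<^sub>M MW" using W by (rule measurable_P)
  have [measurable]: "E \<in> sets (MV \<Otimes>\<^sub>M MW)" by fact
  interpret W: prob_space "distr P MW W" by (rule P.prob_space_distr) simp
  interpret WW: pair_sigma_finite marginal "distr P MW W" ..
  have "emeasure (marginal \<Otimes>\<^sub>M distr P MW W) E
      = (\<integral>\<^sup>+w. emeasure marginal ((\<lambda>v. (v, w)) -` E) \<partial>distr P MW W)"
    by (rule WW.emeasure_pair_measure_alt2) (simp cong: sets_pair_measure_cong)
  also have "\<dots> = (\<integral>\<^sup>+x. emeasure marginal ((\<lambda>v. (v, W x)) -` E) \<partial>P)"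
    using WW.measurable_emeasure_Pair2[of E]
    by (subst nn_integral_distr) (auto cong: sets_pair_measure_cong)
  also have "\<dots> = (\<integral>\<^sup>+x. emeasure marginal {v \<in> space MV. (v, W x) \<in> E} \<partial>P)"
    using sets.sets_into_space[OF E]
    by (intro nn_integral_cong arg_cong2[where f = emeasure]) (auto simp: space_pair_measure)
  finally show ?thesis .
qed

lemma emeasure_joint_singleton:
  assumes x: "x \<in> A" and F: "F \<in> sets MV"
  shows "emeasure (P \<Otimes>\<^sub>M Q) {\<omega> \<in> space (P \<Otimes>\<^sub>M Q). V \<omega> \<in> F \<and> fst \<omega> = x}
    = emeasure P {x} * emeasure (kernel x) F"
proof -
  have [measurable]: "F \<in> sets MV" by fact
  have "{\<omega> \<in> space (P \<Otimes>\<^sub>M Q). V \<omega> \<in> F \<and> fst \<omega> = x} = {x} \<times> ((\<lambda>\<theta>. V (x, \<theta>)) -` F \<inter> space Q)"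
    using x by (auto simp: space_pair_measure space_P)
  then show ?thesis
    using x measurable_sets[OF V_Pair F] by (simp add: kernel_def emeasure_distr V_Pair Q.emeasure_pair_measure_Times sets_P)
qed

lemma kernel_le_marginal:
  assumes x: "x \<in> A" and F: "F \<in> sets MV"
  shows "emeasure P {x} * emeasure (kernel x) F \<le> emeasure marginal F"
proof -
  have [measurable]: "F \<in> sets MV" by fact
  show ?thesis
    unfolding emeasure_joint_singleton[OF assms, symmetric] marginal_def
    by (subst emeasure_distr) (auto intro!: emeasure_mono)
qed

lemma emeasure_marginal:
  assumes F: "F \<in> sets MV"
  shows "emeasure marginal F = (\<integral>\<^sup>+x. emeasure (kernel x) F \<partial>P)"
proof -
  have [measurable]: "F \<in> sets MV" by fact
  have "emeasure marginal F = emeasure (P \<Otimes>\<^sub>M Q) (V -` F \<inter> space (P \<Otimes>\<^sub>M Q))"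
    unfolding marginal_def by (rule emeasure_distr) simp_all
  also have "\<dots> = (\<integral>\<^sup>+x. emeasure Q (Pair x -` (V -` F \<inter> space (P \<Otimes>\<^sub>M Q))) \<partial>P)"
    by (rule Q.emeasure_pair_measure_alt) simp
  also have "\<dots> = (\<integral>\<^sup>+x. emeasure (kernel x) F \<partial>P)"
    unfolding kernel_def
    by (intro nn_integral_cong, subst emeasure_distr[OF V_Pair F])
      (auto simp: space_P space_pair_measure intro!: arg_cong2[where f = emeasure])
  finally show ?thesis .
qed

lemma mutual_information_eq_0:
  assumes W: "W \<in> A \<rightarrow> space MW"
    and const: "\<And>x y. x \<in> A \<Longrightarrow> y \<in> A \<Longrightarrow> kernel x = kernel y"
  shows "J.mutual_information b MV MW V (\<lambda>\<omega>. W (fst \<omega>)) = 0"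
proof -
  have [measurable]: "W \<in> P \<rightarrow>\<^sub>M MW" using W by (rule measurable_P)
  interpret W: prob_space "distr P MW W" by (rule P.prob_space_distr) simp
  interpret WW: pair_sigma_finite marginal "distr P MW W" ..
  have "kernel x = marginal" if "x \<in> A" for x
  proof (rule measure_eqI)
    fix F assume "F \<in> sets (kernel x)"
    then have F: "F \<in> sets MV" by simp
    have "emeasure marginal F = (\<integral>\<^sup>+y. emeasure (kernel y) F \<partial>P)"
      using F by (rule emeasure_marginal)
    also have "\<dots> = (\<integral>\<^sup>+y. emeasure (kernel x) F \<partial>P)"
      using const[OF _ that] by (intro nn_integral_cong) (auto simp: space_P)
    finally show "emeasure (kernel x) F = emeasure marginal F"
      by (simp add: P.emeasure_space_1)
  qed simp
  note kernel_eq = this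
  have "distr (P \<Otimes>\<^sub>M Q) (MV \<Otimes>\<^sub>M MW) (\<lambda>\<omega>. (V \<omega>, W (fst \<omega>))) = marginal \<Otimes>\<^sub>M distr P MW W"
    (is "?L = ?R")
  proof (rule measure_eqI)
    show "sets ?L = sets ?R" by (simp cong: sets_pair_measure_cong)
    fix E assume "E \<in> sets ?L"
    then have E: "E \<in> sets (MV \<Otimes>\<^sub>M MW)" by simp
    show "emeasure ?L E = emeasure ?R E"
      unfolding emeasure_joint[OF W E] emeasure_product[OF W E]
      by (intro nn_integral_cong) (simp add: space_P kernel_eq)
  qed
  then show ?thesis
    unfolding J.mutual_information_def distr_data[OF W] marginal_def[symmetric]
    by (simp add: WW.P.KL_same_eq_0)
qed

lemma kernel_eq_marginal:
  assumes W: "W \<in> A \<rightarrow> space MW" and sing: "{W x} \<in> sets MW"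
    and inj: "\<And>y. y \<in> A \<Longrightarrow> W y = W x \<Longrightarrow> y = x"
    and "1 < b" and MI: "J.mutual_information b MV MW V (\<lambda>\<omega>. W (fst \<omega>)) = 0"
    and x: "x \<in> A" "emeasure P {x} \<noteq> 0"
  shows "kernel x = marginal"
proof -
  have [measurable]: "W \<in> P \<rightarrow>\<^sub>M MW" using W by (rule measurable_P)
  interpret W: prob_space "distr P MW W" by (rule P.prob_space_distr) simp
  interpret WW: pair_prob_space marginal "distr P MW W" ..
  let ?N = "distr (P \<Otimes>\<^sub>M Q) (MV \<Otimes>\<^sub>M MW) (\<lambda>\<omega>. (V \<omega>, W (fst \<omega>)))"
  define c where "c = (\<Sum>y\<in>A. 1 / measure P {y})"
  have c: "1 \<le> c * measure P {y}" if "y \<in> A" "emeasure P {y} \<noteq> 0" for y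
  proof -
    have pos: "0 < measure P {y}"
      using that(2) by (simp add: P.emeasure_eq_measure zero_less_measure_iff)
    have "1 / measure P {y} \<le> c"
      unfolding c_def using that(1) finite_A by (intro member_le_sum) auto
    with pos show ?thesis by (simp add: field_simps)
  qed
  have "?N = marginal \<Otimes>\<^sub>M distr P MW W"
  proof (rule WW.P.KL_divergence_eq_0_imp_eq[of _ b c])
    show "prob_space ?N" by (rule J.prob_space_distr) simp
    show "sets ?N = sets (marginal \<Otimes>\<^sub>M distr P MW W)"
      by (simp cong: sets_pair_measure_cong)
    show "0 \<le> c" unfolding c_def by (intro sum_nonneg) simp
    show "KL_divergence b (marginal \<Otimes>\<^sub>M distr P MW W) ?N = 0"
      using MI unfolding J.mutual_information_def distr_data[OF W] marginal_def .
  next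
    fix E assume "E \<in> sets (marginal \<Otimes>\<^sub>M distr P MW W)"
    then have E: "E \<in> sets (MV \<Otimes>\<^sub>M MW)" by (simp cong: sets_pair_measure_cong)
    have le: "emeasure (kernel y) F \<le> ennreal c * emeasure marginal F"
      if y: "y \<in> A" "emeasure P {y} \<noteq> 0" and F: "F \<in> sets MV" for y F
    proof -
      have "emeasure (kernel y) F \<le> ennreal (c * measure P {y}) * emeasure (kernel y) F"
        using c[OF y] mult_right_mono[of 1 "ennreal (c * measure P {y})" "emeasure (kernel y) F"]
        by (simp add: ennreal_leI)
      also have "\<dots> = ennreal c * (emeasure P {y} * emeasure (kernel y) F)"
        by (simp add: P.emeasure_eq_measure ennreal_mult'' mult.assoc)
      also have "\<dots> \<le> ennreal c * emeasure marginal F"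
        using kernel_le_marginal[OF y(1) F] by (intro mult_left_mono) auto
      finally show ?thesis .
    qed
    have "emeasure ?N E
        \<le> (\<integral>\<^sup>+x. ennreal c * emeasure marginal {v \<in> space MV. (v, W x) \<in> E} \<partial>P)"
      unfolding emeasure_joint[OF W E]
    proof (rule nn_integral_mono_AE, use AE_P in eventually_elim)
      fix y assume y: "y \<in> A \<and> emeasure P {y} \<noteq> 0"
      have [measurable]: "E \<in> sets (MV \<Otimes>\<^sub>M MW)" and "W y \<in> space MW" using E W y by (auto simp: Pi_iff)
      then have "{v \<in> space MV. (v, W y) \<in> E} \<in> sets MV" by measurable
      with y show "emeasure (kernel y) {v \<in> space MV. (v, W y) \<in> E}
          \<le> ennreal c * emeasure marginal {v \<in> space MV. (v, W y) \<in> E}"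
        by (intro le) auto
    qed
    also have "\<dots> = ennreal c * emeasure (marginal \<Otimes>\<^sub>M distr P MW W) E"
      unfolding emeasure_product[OF W E] by (rule nn_integral_cmult) (simp add: measurable_P)
    finally show "emeasure ?N E \<le> ennreal c * emeasure (marginal \<Otimes>\<^sub>M distr P MW W) E" .
  qed (use \<open>1 < b\<close> in auto)
  note joint_eq = this
  show ?thesis
  proof (rule measure_eqI)
    fix F assume "F \<in> sets (kernel x)"
    then have F[measurable]: "F \<in> sets MV" by simp
    have [measurable]: "{W x} \<in> sets MW" by fact
    have "emeasure P {x} * emeasure (kernel x) F = emeasure ?N (F \<times> {W x})"
      unfolding emeasure_joint_singleton[OF x(1) F, symmetric]
      by (subst emeasure_distr)
        (auto intro!: arg_cong2[where f = emeasure] simp: space_pair_measure space_P dest: inj)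
    also have "\<dots> = emeasure marginal F * emeasure (distr P MW W) {W x}"
      unfolding joint_eq by (rule W.emeasure_pair_measure_Times) simp_all
    also have "emeasure (distr P MW W) {W x} = emeasure P {x}"
      using x(1) by (subst emeasure_distr)
        (auto intro!: arg_cong2[where f = emeasure] simp: space_P dest: inj)
    finally show "emeasure (kernel x) F = emeasure marginal F"
      using x(2) by (simp add: mult.commute ennreal_mult_cancel_left P.emeasure_eq_measure)
  qed simp
qed

lemma mutual_information_AE_const:
  assumes Z: "AE x in P. Z x = z" and space: "space MZ = UNIV"
  shows "J.mutual_information b MV MZ V (\<lambda>\<omega>. Z (fst \<omega>)) = 0"
proof -
  have [measurable]: "Z \<in> P \<rightarrow>\<^sub>M MZ" by (rule measurable_P) (simp add: space)
  interpret Z: prob_space "distr P MZ Z" by (rule P.prob_space_distr) simp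
  interpret ZZ: pair_prob_space marginal "distr P MZ Z" ..
  let ?N = "distr (P \<Otimes>\<^sub>M Q) (MV \<Otimes>\<^sub>M MZ) (\<lambda>\<omega>. (V \<omega>, Z (fst \<omega>)))"
  have "?N = marginal \<Otimes>\<^sub>M distr P MZ Z" (is "_ = ?R")
  proof (rule measure_eqI)
    show "sets ?N = sets ?R" by (simp cong: sets_pair_measure_cong)
    fix E assume "E \<in> sets ?N"
    then have E: "E \<in> sets (MV \<Otimes>\<^sub>M MZ)" by simp
    let ?F = "{v \<in> space MV. (v, z) \<in> E}"
    have [measurable]: "E \<in> sets (MV \<Otimes>\<^sub>M MZ)" by fact
    have [measurable]: "z \<in> space MZ" by (simp add: space)
    have F: "?F \<in> sets MV" by measurable
    have "emeasure ?N E = (\<integral>\<^sup>+x. emeasure (kernel x) ?F \<partial>P)"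
      using Z by (subst emeasure_joint[OF _ E])
        (auto simp: space intro!: nn_integral_cong_AE elim!: eventually_mono)
    also have "\<dots> = emeasure marginal ?F"
      using emeasure_marginal[OF F] by simp
    also have "\<dots> = (\<integral>\<^sup>+x. emeasure marginal ?F \<partial>P)"
      by (simp add: P.emeasure_space_1)
    also have "\<dots> = (\<integral>\<^sup>+x. emeasure marginal {v \<in> space MV. (v, Z x) \<in> E} \<partial>P)"
      by (rule nn_integral_cong_AE) (use Z in \<open>auto elim!: eventually_mono\<close>)
    also have "\<dots> = emeasure ?R E"
      by (rule emeasure_product[OF _ E, symmetric]) (simp add: space)
    finally show "emeasure ?N E = emeasure ?R E" .
  qed
  then show ?thesis
    unfolding J.mutual_information_def
    by (subst distr_data) (simp_all add: space ZZ.P.KL_same_eq_0 marginal_def[symmetric])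
qed

lemma joint_density:
  fixes D :: "'v \<times> 'z \<Rightarrow> real"
  assumes W: "W \<in> A \<rightarrow> space MW" and \<phi>: "\<phi> \<in> MW \<rightarrow>\<^sub>M MZ"
    and D: "D \<in> borel_measurable (MV \<Otimes>\<^sub>M MZ)"
    and kernel: "\<And>x. x \<in> A \<Longrightarrow> emeasure P {x} \<noteq> 0 \<Longrightarrow>
      density marginal (\<lambda>v. ennreal (D (v, \<phi> (W x)))) = kernel x"
  shows "density (marginal \<Otimes>\<^sub>M distr P MW W) (\<lambda>u. ennreal (D (fst u, \<phi> (snd u))))
    = distr (P \<Otimes>\<^sub>M Q) (MV \<Otimes>\<^sub>M MW) (\<lambda>\<omega>. (V \<omega>, W (fst \<omega>)))" (is "?L = ?R")
proof (rule measure_eqI)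
  note [measurable] = \<phi> D
  have [measurable]: "W \<in> P \<rightarrow>\<^sub>M MW" using W by (rule measurable_P)
  interpret W: prob_space "distr P MW W" by (rule P.prob_space_distr) simp
  interpret WW: pair_sigma_finite marginal "distr P MW W" ..
  show sets: "sets ?L = sets ?R" by (simp cong: sets_pair_measure_cong)
  fix E assume "E \<in> sets ?L"
  then have E[measurable]: "E \<in> sets (MV \<Otimes>\<^sub>M MW)" using sets by simp
  have "emeasure ?L E
      = (\<integral>\<^sup>+u. ennreal (D (fst u, \<phi> (snd u))) * indicator E u \<partial>(marginal \<Otimes>\<^sub>M distr P MW W))"
    by (rule emeasure_density) measurable
  also have "\<dots> = (\<integral>\<^sup>+w. \<integral>\<^sup>+v. ennreal (D (v, \<phi> w)) * indicator E (v, w) \<partial>marginal \<partial>distr P MW W)"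
    by (subst WW.nn_integral_snd[symmetric]) simp_all
  also have "\<dots> = (\<integral>\<^sup>+x. \<integral>\<^sup>+v. ennreal (D (v, \<phi> (W x))) * indicator E (v, W x) \<partial>marginal \<partial>P)"
    by (rule nn_integral_distr) measurable
  also have "\<dots> = (\<integral>\<^sup>+x. emeasure (kernel x) {v \<in> space MV. (v, W x) \<in> E} \<partial>P)"
  proof (rule nn_integral_cong_AE, use AE_P in eventually_elim)
    fix x assume x: "x \<in> A \<and> emeasure P {x} \<noteq> 0"
    then have [measurable]: "W x \<in> space MW" using W by auto
    have "emeasure (kernel x) {v \<in> space MV. (v, W x) \<in> E}
        = (\<integral>\<^sup>+v. ennreal (D (v, \<phi> (W x))) * indicator {v \<in> space MV. (v, W x) \<in> E} v \<partial>marginal)"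
      using x kernel[of x, symmetric] by (simp add: emeasure_density)
    also have "\<dots> = (\<integral>\<^sup>+v. ennreal (D (v, \<phi> (W x))) * indicator E (v, W x) \<partial>marginal)"
      by (rule nn_integral_cong) (auto simp: indicator_def)
    finally show "(\<integral>\<^sup>+v. ennreal (D (v, \<phi> (W x))) * indicator E (v, W x) \<partial>marginal)
        = emeasure (kernel x) {v \<in> space MV. (v, W x) \<in> E}" ..
  qed
  also have "\<dots> = emeasure ?R E"
    by (rule emeasure_joint[OF W E, symmetric])
  finally show "emeasure ?L E = emeasure ?R E" .
qed

lemma mutual_information_density:
  fixes D :: "'v \<times> 'z \<Rightarrow> real"
  assumes W: "W \<in> A \<rightarrow> space MW" and \<phi>: "\<phi> \<in> MW \<rightarrow>\<^sub>M MZ"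
    and D: "D \<in> borel_measurable (MV \<Otimes>\<^sub>M MZ)" "\<And>u. 0 \<le> D u"
    and kernel: "\<And>x. x \<in> A \<Longrightarrow> emeasure P {x} \<noteq> 0 \<Longrightarrow>
      density marginal (\<lambda>v. ennreal (D (v, \<phi> (W x)))) = kernel x"
    and "1 < b"
  shows "J.mutual_information b MV MW V (\<lambda>\<omega>. W (fst \<omega>))
    = (\<integral>u. D u * log b (D u) \<partial>(marginal \<Otimes>\<^sub>M distr P MZ (\<lambda>x. \<phi> (W x))))"
proof -
  note [measurable] = \<phi> D(1)
  have [measurable]: "W \<in> P \<rightarrow>\<^sub>M MW" using W by (rule measurable_P)
  interpret W: prob_space "distr P MW W" by (rule P.prob_space_distr) simp
  interpret WW: pair_prob_space marginal "distr P MW W" ..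
  interpret Z: prob_space "distr (distr P MW W) MZ \<phi>" by (rule W.prob_space_distr) simp
  let ?f = "\<lambda>u. (fst u, \<phi> (snd u))"
  have "distr marginal MV (\<lambda>v. v) = marginal"
    by (rule distr_id2) simp
  then have eq: "marginal \<Otimes>\<^sub>M distr P MZ (\<lambda>x. \<phi> (W x))
      = distr (marginal \<Otimes>\<^sub>M distr P MW W) (MV \<Otimes>\<^sub>M MZ) ?f"
    using pair_measure_distr[of "\<lambda>v. v" marginal MV \<phi> "distr P MW W" MZ] Z.sigma_finite_measure_axioms
    by (simp add: distr_distr comp_def case_prod_unfold)
  have "J.mutual_information b MV MW V (\<lambda>\<omega>. W (fst \<omega>))
      = KL_divergence b (marginal \<Otimes>\<^sub>M distr P MW W)
          (density (marginal \<Otimes>\<^sub>M distr P MW W) (\<lambda>u. ennreal (D (?f u))))"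
    unfolding J.mutual_information_def distr_data[OF W] marginal_def[symmetric]
    using joint_density[OF W \<phi> D(1) kernel] by simp
  also have "\<dots> = (\<integral>u. D (?f u) * log b (D (?f u)) \<partial>(marginal \<Otimes>\<^sub>M distr P MW W))"
    by (rule WW.P.KL_density) (use \<open>1 < b\<close> D(2) in auto)
  also have "\<dots> = (\<integral>u. D u * log b (D u) \<partial>distr (marginal \<Otimes>\<^sub>M distr P MW W) (MV \<Otimes>\<^sub>M MZ) ?f)"
    by (rule integral_distr[symmetric]) measurable
  finally show ?thesis unfolding eq .
qed

lemma conditional_mutual_information_eq_0:
  assumes X: "X \<in> A \<rightarrow> space MX" and Z: "Z \<in> A \<rightarrow> space MZ"
    and sing: "\<And>x. x \<in> A \<Longrightarrow> {Z x} \<in> sets MZ"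
    and const: "\<And>x y. x \<in> A \<Longrightarrow> y \<in> A \<Longrightarrow> Z x = Z y \<Longrightarrow> kernel x = kernel y"
    and "1 < b"
  shows "J.conditional_mutual_information b MV MX MZ V (\<lambda>\<omega>. X (fst \<omega>)) (\<lambda>\<omega>. Z (fst \<omega>)) = 0"
proof -
  have "\<exists>f. f \<in> borel_measurable MV \<and> (\<forall>v. 0 \<le> f v) \<and> density marginal (\<lambda>v. ennreal (f v)) = kernel x"
    if x: "x \<in> A" "emeasure P {x} \<noteq> 0" for x
  proof -
    interpret K: prob_space "kernel x" using x(1) by (rule prob_space_kernel)
    have ac: "absolutely_continuous marginal (kernel x)"
      unfolding absolutely_continuous_def
    proof
      fix F assume F: "F \<in> null_sets marginal"
      then have "emeasure P {x} * emeasure (kernel x) F = 0"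
        using kernel_le_marginal[OF x(1), of F] by (auto simp: null_sets_def)
      then show "F \<in> null_sets (kernel x)"
        using x(2) F by (auto simp: null_sets_def)
    qed
    obtain f where f: "f \<in> borel_measurable marginal"
        "AE v in marginal. RN_deriv marginal (kernel x) v = ennreal (f v)" "\<And>v. 0 \<le> f v"
      using marginal.real_RN_deriv[OF K.finite_measure_axioms ac] by (metis sets_kernel sets_marginal)
    have "kernel x = density marginal (RN_deriv marginal (kernel x))"
      using ac by (intro marginal.density_RN_deriv[symmetric]) simp_all
    also have "\<dots> = density marginal f"
      using f by (intro density_cong) auto
    finally have "density marginal f = kernel x" ..
    moreover have "f \<in> borel_measurable MV"
      using f(1) by simp
    ultimately show ?thesis using f(3) by blast
  qed
  then obtain f where f: "\<And>x. x \<in> A \<Longrightarrow> emeasure P {x} \<noteq> 0 \<Longrightarrow> f x \<in> borel_measurable MV \<and>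
      (\<forall>v. 0 \<le> f x v) \<and> density marginal (\<lambda>v. ennreal (f x v)) = kernel x"
    by metis
  define B where "B = {x \<in> A. emeasure P {x} \<noteq> 0}"
  define g where "g z = f (SOME x. x \<in> B \<and> Z x = z)" for z
  define D where "D = (\<lambda>u. \<Sum>z\<in>Z ` B. g z (fst u) * indicator {z} (snd u))"
  have finB: "finite B" unfolding B_def using finite_A by simp
  have g: "g z \<in> borel_measurable MV \<and> (\<forall>v. 0 \<le> g z v) \<and>
      (\<forall>x\<in>B. Z x = z \<longrightarrow> density marginal (\<lambda>v. ennreal (g z v)) = kernel x)" if "z \<in> Z ` B" for z
  proof -
    have "\<exists>x. x \<in> B \<and> Z x = z" using that by auto
    from someI_ex[OF this] f[of "SOME x. x \<in> B \<and> Z x = z"] show ?thesis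
      unfolding g_def B_def by (auto intro: const)
  qed
  have D_meas: "D \<in> borel_measurable (MV \<Otimes>\<^sub>M MZ)"
    unfolding D_def
  proof (rule borel_measurable_sum)
    fix z assume z: "z \<in> Z ` B"
    then have [measurable]: "{z} \<in> sets MZ" "g z \<in> borel_measurable MV"
      using sing g[OF z] unfolding B_def by auto
    show "(\<lambda>u. g z (fst u) * indicator {z} (snd u)) \<in> borel_measurable (MV \<Otimes>\<^sub>M MZ)"
      by measurable
  qed
  have D_nonneg: "0 \<le> D u" for u
    unfolding D_def using g by (intro sum_nonneg) (auto simp: indicator_def)
  have D_kernel: "density marginal (\<lambda>v. ennreal (D (v, Z x))) = kernel x"
    if "x \<in> A" "emeasure P {x} \<noteq> 0" for x
  proof -
    have x: "x \<in> B" using that by (simp add: B_def)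
    then have "D (v, Z x) = g (Z x) v" for v
      unfolding D_def using finB
      by (subst sum.remove[of _ "Z x"]) (auto simp: indicator_def intro!: sum.neutral)
    then show ?thesis using g[of "Z x"] x by auto
  qed
  have XZ: "(\<lambda>x. (X x, Z x)) \<in> A \<rightarrow> space (MX \<Otimes>\<^sub>M MZ)"
    using X Z by (auto simp: space_pair_measure)
  have "J.mutual_information b MV (MX \<Otimes>\<^sub>M MZ) V (\<lambda>\<omega>. (X (fst \<omega>), Z (fst \<omega>)))
      = (\<integral>u. D u * log b (D u) \<partial>(marginal \<Otimes>\<^sub>M distr P MZ Z))"
    using mutual_information_density[OF XZ measurable_snd D_meas D_nonneg _ \<open>1 < b\<close>] D_kernel
    by simp
  moreover have "J.mutual_information b MV MZ V (\<lambda>\<omega>. Z (fst \<omega>))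
      = (\<integral>u. D u * log b (D u) \<partial>(marginal \<Otimes>\<^sub>M distr P MZ Z))"
    using mutual_information_density[OF Z measurable_ident_sets[OF refl] D_meas D_nonneg _ \<open>1 < b\<close>] D_kernel
    by simp
  ultimately show ?thesis
    unfolding J.conditional_mutual_information_def by simp
qed

end

section \<open>The masking protocol\<close>

definition linear_form :: "nat set \<Rightarrow> (nat \<Rightarrow> nat) \<Rightarrow> (nat \<Rightarrow> nat) \<Rightarrow> nat" where
  "linear_form K a u = (\<Sum>k\<in>K. a k * u k)"

lemma card_linear_form_eq_le:
  assumes K: "finite K" "k \<in> K" and neq: "u k \<noteq> u' k"
  shows "card {a \<in> K \<rightarrow>\<^sub>E {..<B}. linear_form K a u = linear_form K a u'} \<le> B ^ (card K - 1)"
    (is "card ?E \<le> _")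
proof -
  let ?r = "\<lambda>a. restrict a (K - {k})"
  have "inj_on ?r ?E"
  proof (rule inj_onI)
    fix a b assume a: "a \<in> ?E" and b: "b \<in> ?E" and eq: "?r a = ?r b"
    have off: "a j = b j" if "j \<in> K - {k}" for j
      using fun_cong[OF eq, of j] that by simp
    define r where "r = (\<Sum>j\<in>K - {k}. a j * u j)"
    define r' where "r' = (\<Sum>j\<in>K - {k}. a j * u' j)"
    have split: "linear_form K c v = c k * v k + (\<Sum>j\<in>K - {k}. c j * v j)" for c v
      unfolding linear_form_def using K by (rule sum.remove)
    have "a k * u k + r = a k * u' k + r'"
      using a unfolding r_def r'_def by (simp add: split)
    moreover have "b k * u k + r = b k * u' k + r'"
    proof -
      have "r = (\<Sum>j\<in>K - {k}. b j * u j)" "r' = (\<Sum>j\<in>K - {k}. b j * u' j)"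
        unfolding r_def r'_def using off by (auto intro!: sum.cong)
      then show ?thesis using b by (simp add: split)
    qed
    ultimately have "(int (a k) - int (b k)) * (int (u k) - int (u' k)) = 0"
      by (simp add: algebra_simps flip: of_nat_mult of_nat_add)
    then have "a k = b k" using neq by simp
    then show "a = b"
      using a b off by (intro PiE_ext[of a K _ b]) (auto, metis)
  qed
  moreover have "?r ` ?E \<subseteq> (K - {k}) \<rightarrow>\<^sub>E {..<B}"
    by (auto simp: PiE_iff split: if_splits)
  ultimately have "card ?E \<le> card ((K - {k}) \<rightarrow>\<^sub>E {..<B})"
    using K by (intro card_inj_on_le[of ?r]) (auto intro: finite_PiE)
  also have "\<dots> = B ^ (card K - 1)"
    using K by (simp add: card_PiE)
  finally show ?thesis .
qed

text \<open>A union bound over the pairs of points that a random form could identify.\<close>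

lemma injective_linear_form_exists:
  assumes K: "finite K" and H: "finite H" and supp: "\<And>u k. u \<in> H \<Longrightarrow> k \<notin> K \<Longrightarrow> u k = 0"
    and B: "(card H)\<^sup>2 < B"
  shows "\<exists>a\<in>K \<rightarrow>\<^sub>E {..<B}. inj_on (linear_form K a) H"
proof -
  define N where "N = {p \<in> H \<times> H. fst p \<noteq> snd p}"
  define bad where "bad p = {a \<in> K \<rightarrow>\<^sub>E {..<B}. linear_form K a (fst p) = linear_form K a (snd p)}" for p
  have diff: "\<exists>k\<in>K. fst p k \<noteq> snd p k" if "p \<in> N" for p
  proof -
    have p: "fst p \<in> H" "snd p \<in> H" "fst p \<noteq> snd p" using that by (auto simp: N_def)
    then obtain k where k: "fst p k \<noteq> snd p k" by (auto simp: fun_eq_iff)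
    with supp[OF p(1), of k] supp[OF p(2), of k] have "k \<in> K" by fastforce
    with k show ?thesis by blast
  qed
  have finN: "finite N" and cardN: "card N \<le> (card H)\<^sup>2"
    using H card_mono[of "H \<times> H" N] unfolding N_def by (auto simp: power2_eq_square card_cartesian_product)
  have "card (\<Union>(bad ` N)) < card (K \<rightarrow>\<^sub>E {..<B})"
  proof (cases "N = {}")
    case True
    then show ?thesis using B K by (simp add: card_PiE)
  next
    case False
    then have "card K > 0" using diff K by (auto simp: card_gt_0_iff)
    have "card (\<Union>(bad ` N)) \<le> (\<Sum>p\<in>N. card (bad p))"
      using finN by (rule card_UN_le)
    also have "\<dots> \<le> (\<Sum>p\<in>N. B ^ (card K - 1))"
      using diff K unfolding bad_def by (intro sum_mono) (blast intro: card_linear_form_eq_le)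
    also have "\<dots> = card N * B ^ (card K - 1)" by simp
    also have "\<dots> < B * B ^ (card K - 1)"
      using cardN B by (intro mult_strict_right_mono) auto
    also have "\<dots> = card (K \<rightarrow>\<^sub>E {..<B})"
      using K \<open>card K > 0\<close> by (simp add: card_PiE flip: power_Suc)
    finally show ?thesis .
  qed
  moreover have "\<Union>(bad ` N) \<subseteq> K \<rightarrow>\<^sub>E {..<B}" unfolding bad_def by auto
  ultimately obtain a where "a \<in> K \<rightarrow>\<^sub>E {..<B}" "a \<notin> \<Union>(bad ` N)"
    by (metis (no_types, lifting) less_irrefl subsetI subset_antisym)
  then show ?thesis
    unfolding bad_def N_def inj_on_def by fastforce
qed

definition histograms :: "nat \<Rightarrow> nat \<Rightarrow> (nat \<Rightarrow> nat) set" where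
  "histograms n d = {aggregate A x |A x. A \<subseteq> {1..n} \<and> x \<in> user_data d A}"

lemma aggregate_in_histograms: "A \<subseteq> {1..n} \<Longrightarrow> x \<in> A \<rightarrow> one_hot d \<Longrightarrow> aggregate A x \<in> histograms n d"
  unfolding histograms_def
  by (auto intro!: exI[of _ A] exI[of _ "restrict x A"] simp: aggregate_def)

lemma histograms_subset:
  "histograms n d \<subseteq> aggregate {1..n} ` ({1..n} \<rightarrow>\<^sub>E insert (\<lambda>_. 0) (one_hot d))"
proof
  fix u assume "u \<in> histograms n d"
  then obtain A x where A: "A \<subseteq> {1..n}" and x: "x \<in> user_data d A" and u: "u = aggregate A x"
    unfolding histograms_def by auto
  let ?y = "\<lambda>i\<in>{1..n}. if i \<in> A then x i else (\<lambda>_. 0)"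
  have "aggregate {1..n} ?y = u"
  proof
    fix k
    have "(\<Sum>i\<in>{1..n}. ?y i k) = (\<Sum>i\<in>{1..n}. if i \<in> A then x i k else 0)"
      by (intro sum.cong) auto
    also have "\<dots> = (\<Sum>i\<in>A. x i k)"
      using A by (simp add: sum.If_cases Int_absorb1 Int_absorb2)
    finally show "aggregate {1..n} ?y k = u k" by (simp add: u aggregate_def)
  qed
  moreover have "?y \<in> {1..n} \<rightarrow>\<^sub>E insert (\<lambda>_. 0) (one_hot d)"
    using PiE_mem[OF x] by (auto simp del: insert_iff simp: insertI2)
  ultimately show "u \<in> aggregate {1..n} ` ({1..n} \<rightarrow>\<^sub>E insert (\<lambda>_. 0) (one_hot d))"
    by blast
qed

lemma unit_vector_eq_iff: "unit_vector j = unit_vector k \<longleftrightarrow> j = k"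
  by (auto simp: unit_vector_def fun_eq_iff split: if_splits)

lemma finite_one_hot: "finite (one_hot d)" and card_one_hot: "card (one_hot d) = d"
  unfolding one_hot_def by (auto simp: card_image inj_on_def unit_vector_eq_iff)

lemma finite_histograms: "finite (histograms n d)"
  and card_histograms_le: "card (histograms n d) \<le> (d + 1) ^ n"
proof -
  let ?F = "{1..n} \<rightarrow>\<^sub>E insert (\<lambda>_. 0::nat) (one_hot d)"
  have fin: "finite ?F" by (auto intro!: finite_PiE finite_one_hot)
  then show "finite (histograms n d)"
    by (rule finite_subset[OF histograms_subset finite_imageI])
  have "card (histograms n d) \<le> card (aggregate {1..n} ` ?F)"
    using fin by (intro card_mono histograms_subset finite_imageI)
  also have "\<dots> \<le> card ?F" using fin by (rule card_image_le)
  also have "\<dots> = card (insert (\<lambda>_. 0::nat) (one_hot d)) ^ n" by (simp add: card_PiE)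
  also have "\<dots> \<le> (d + 1) ^ n"
    by (intro power_mono order_trans[OF card_insert_le_m1]) (auto simp: card_one_hot card_insert_if finite_one_hot)
  finally show "card (histograms n d) \<le> (d + 1) ^ n" .
qed

lemma linear_form_aggregate:
  "linear_form K a (aggregate A x) = (\<Sum>i\<in>A. linear_form K a (x i))"
  unfolding linear_form_def aggregate_def
  by (subst sum.swap) (simp add: sum_distrib_left)

lemma linear_form_one_hot:
  assumes "v \<in> one_hot d" and a: "a \<in> {1..d} \<rightarrow> {..<B}"
  shows "linear_form {1..d} a v < B"
proof -
  obtain j where j: "j \<in> {1..d}" "v = unit_vector j" using assms by (auto simp: one_hot_def)
  have "linear_form {1..d} a v = (\<Sum>k\<in>{1..d}. if k = j then a k else 0)"
    unfolding linear_form_def j unit_vector_def by (intro sum.cong) auto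
  then show ?thesis using j(1) a by auto
qed

definition zero_sum_masks :: "nat \<Rightarrow> int \<Rightarrow> (nat \<Rightarrow> int) set" where
  "zero_sum_masks n m = {t \<in> {1..n} \<rightarrow>\<^sub>E {0..<m}. m dvd (\<Sum>i\<in>{1..n}. t i)}"

lemma finite_zero_sum_masks: "finite (zero_sum_masks n m)"
  unfolding zero_sum_masks_def by (rule finite_subset[OF _ finite_PiE[of "{1..n}" "\<lambda>_. {0..<m}"]]) auto

lemma zero_sum_masks_nonempty: "0 < m \<Longrightarrow> zero_sum_masks n m \<noteq> {}"
  unfolding zero_sum_masks_def by (auto intro!: exI[of _ "\<lambda>i\<in>{1..n}. 0"])

definition shift_mask :: "nat \<Rightarrow> int \<Rightarrow> (nat \<Rightarrow> int) \<Rightarrow> (nat \<Rightarrow> int) \<Rightarrow> nat \<Rightarrow> int" where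
  "shift_mask n m \<delta> t = (\<lambda>i\<in>{1..n}. (t i + \<delta> i) mod m)"

lemma shift_mask_in:
  assumes "0 < m" and \<delta>: "m dvd (\<Sum>i\<in>{1..n}. \<delta> i)" and t: "t \<in> zero_sum_masks n m"
  shows "shift_mask n m \<delta> t \<in> zero_sum_masks n m"
proof -
  have "(\<Sum>i\<in>{1..n}. shift_mask n m \<delta> t i) mod m = (\<Sum>i\<in>{1..n}. t i + \<delta> i) mod m"
    by (simp add: shift_mask_def mod_sum_eq)
  also have "\<dots> = 0"
    using \<delta> t by (simp add: zero_sum_masks_def sum.distrib)
  finally show ?thesis
    using \<open>0 < m\<close> by (auto simp: zero_sum_masks_def shift_mask_def)
qed

lemma shift_mask_inverse:
  assumes "t \<in> zero_sum_masks n m" and \<epsilon>: "\<And>i. \<epsilon> i = - \<delta> i"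
  shows "shift_mask n m \<epsilon> (shift_mask n m \<delta> t) = t"
proof
  fix i
  have "(((t i + \<delta> i) mod m + - \<delta> i) mod m) = t i mod m"
    by (metis add.right_neutral add.right_inverse add.assoc mod_add_left_eq)
  then show "shift_mask n m \<epsilon> (shift_mask n m \<delta> t) i = t i"
    using assms(1) unfolding zero_sum_masks_def shift_mask_def
    by (auto simp: \<epsilon> PiE_iff extensional_def)
qed

lemma bij_betw_shift_mask:
  assumes "0 < m" "m dvd (\<Sum>i\<in>{1..n}. \<delta> i)"
  shows "bij_betw (shift_mask n m \<delta>) (zero_sum_masks n m) (zero_sum_masks n m)"
  using assms
  by (intro bij_betw_byWitness[where f' = "shift_mask n m (\<lambda>i. - \<delta> i)"])
    (auto intro!: shift_mask_in simp: sum_negf intro: shift_mask_inverse)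

definition real_mask :: "nat \<Rightarrow> (nat \<Rightarrow> int) \<Rightarrow> nat \<Rightarrow> real" where
  "real_mask n t = (\<lambda>i\<in>{1..n}. real_of_int (t i))"

lemma real_mask_measurable: "real_mask n \<in> measure_pmf p \<rightarrow>\<^sub>M Pi\<^sub>M {1..n} (\<lambda>_. borel)"
  unfolding real_mask_def by (intro measurable_restrict) simp

text \<open>
  Additive masking modulo \<open>m\<close> of an integer code \<open>L\<close> of the histograms.
\<close>

definition masking_protocol :: "nat \<Rightarrow> nat \<Rightarrow> nat \<Rightarrow> int \<Rightarrow> ((nat \<Rightarrow> nat) \<Rightarrow> nat) \<Rightarrow> protocol" where
  "masking_protocol n d D m L =
     \<lparr>secrets = distr (measure_pmf (pmf_of_set (zero_sum_masks n m))) (Pi\<^sub>M {1..n} (\<lambda>_. borel)) (real_mask n),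
      enc = (\<lambda>i v r. nat ((int (L v) + \<lfloor>r\<rfloor>) mod m)),
      reveal = (\<lambda>S \<theta>. if card S \<le> D then real_of_int ((\<Sum>i\<in>{1..n} - S. \<lfloor>\<theta> i\<rfloor>) mod m) else 0),
      dec = (\<lambda>S (y, r). inv_into (histograms n d) L
               (nat (((\<Sum>i\<in>{1..n} - S. int (y i)) - \<lfloor>r\<rfloor>) mod m)))\<rparr>"

lemma prob_algebra_iff:
  "M \<in> space (prob_algebra N) \<longleftrightarrow> prob_space M \<and> sets M = sets N"
  by (auto simp: space_prob_algebra)

lemma aggregation_protocol_masking: "aggregation_protocol n d (masking_protocol n d D m L)"
proof -
  have "(\<lambda>\<theta>. \<Sum>i\<in>{1..n} - S. \<lfloor>\<theta> i\<rfloor>) \<in> Pi\<^sub>M {1..n} (\<lambda>_. borel :: real measure) \<rightarrow>\<^sub>M count_space UNIV" for S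
  proof -
    have "(\<lambda>\<theta>::nat \<Rightarrow> real. \<Sum>i\<in>{1..n} - S. real_of_int \<lfloor>\<theta> i\<rfloor>) \<in> borel_measurable (Pi\<^sub>M {1..n} (\<lambda>_. borel))"
    proof (rule borel_measurable_sum)
      fix i assume "i \<in> {1..n} - S"
      then have "(\<lambda>\<theta>. \<theta> i) \<in> Pi\<^sub>M {1..n} (\<lambda>_. borel :: real measure) \<rightarrow>\<^sub>M borel"
        by (intro measurable_component_singleton) simp
      from measurable_compose[OF this borel_measurable_real_floor]
      show "(\<lambda>\<theta>::nat \<Rightarrow> real. real_of_int \<lfloor>\<theta> i\<rfloor>) \<in> borel_measurable (Pi\<^sub>M {1..n} (\<lambda>_. borel))" .
    qed
    then have "(\<lambda>\<theta>::nat \<Rightarrow> real. \<lfloor>\<Sum>i\<in>{1..n} - S. real_of_int \<lfloor>\<theta> i\<rfloor>\<rfloor>) \<in> Pi\<^sub>M {1..n} (\<lambda>_. borel) \<rightarrow>\<^sub>M count_space UNIV"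
      by (rule measurable_compose[OF _ measurable_real_floor])
    then show ?thesis by (simp flip: of_int_sum)
  qed
  then have "(\<lambda>\<theta>::nat \<Rightarrow> real. real_of_int ((\<Sum>i\<in>{1..n} - S. \<lfloor>\<theta> i\<rfloor>) mod m)) \<in> Pi\<^sub>M {1..n} (\<lambda>_. borel) \<rightarrow>\<^sub>M borel" for S
    by (rule measurable_compose) simp
  moreover have "(\<lambda>r::real. nat ((int (L v) + \<lfloor>r\<rfloor>) mod m)) \<in> borel \<rightarrow>\<^sub>M count_space UNIV" for v
    by measurable
  ultimately show ?thesis
    unfolding aggregation_protocol_def masking_protocol_def
    by (auto simp: prob_algebra_iff simp del: One_nat_def
      intro!: measure_pmf.prob_space_distr[OF real_mask_measurable])
qed

lemma finite_channel_view:
  assumes \<pi>: "aggregation_protocol n d \<pi>" and P: "P \<in> data_laws n d" and S: "S \<subseteq> {1..n}"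
  shows "finite_channel P (secrets \<pi>) (user_data d {1..n}) (view_space n S) (view n \<pi> S)"
proof -
  have "prob_space P" "sets P = Pow (user_data d {1..n})" "prob_space (secrets \<pi>)"
    using \<pi> P by (auto simp: aggregation_protocol_def data_laws_def prob_algebra_iff)
  moreover have "view n \<pi> S \<in> P \<Otimes>\<^sub>M secrets \<pi> \<rightarrow>\<^sub>M view_space n S"
    using view_measurable[OF assms] by (simp add: joint_law_def)
  ultimately show ?thesis
    by (simp add: finite_channel_def finite_channel_axioms_def finite_user_data)
qed

lemma masking_view_law_eq:
  fixes n d D :: nat and m :: int and L :: "(nat \<Rightarrow> nat) \<Rightarrow> nat"
  defines "\<pi> \<equiv> masking_protocol n d D m L"
  assumes "0 < m"
    and \<delta>: "m dvd (\<Sum>i\<in>{1..n}. \<delta> i)" "\<And>i. i \<in> {1..n} - S \<Longrightarrow> \<delta> i = int (L (x i)) - int (L (x' i))"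
      "card S \<le> D \<Longrightarrow> m dvd (\<Sum>i\<in>{1..n} - S. \<delta> i)"
    and meas: "(\<lambda>\<theta>. view n \<pi> S (x, \<theta>)) \<in> secrets \<pi> \<rightarrow>\<^sub>M N" "(\<lambda>\<theta>. view n \<pi> S (x', \<theta>)) \<in> secrets \<pi> \<rightarrow>\<^sub>M N"
  shows "distr (secrets \<pi>) N (\<lambda>\<theta>. view n \<pi> S (x, \<theta>)) = distr (secrets \<pi>) N (\<lambda>\<theta>. view n \<pi> S (x', \<theta>))"
proof -
  let ?T = "zero_sum_masks n m" and ?\<sigma> = "shift_mask n m \<delta>"
  let ?p = "pmf_of_set ?T"
  have sec: "secrets \<pi> = distr (measure_pmf ?p) (Pi\<^sub>M {1..n} (\<lambda>_. borel)) (real_mask n)"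
    by (simp add: \<pi>_def masking_protocol_def)
  have ne: "?T \<noteq> {}" using \<open>0 < m\<close> by (rule zero_sum_masks_nonempty)
  have law: "distr (secrets \<pi>) N f = distr (measure_pmf ?p) N (\<lambda>t. f (real_mask n t))"
    if "f \<in> secrets \<pi> \<rightarrow>\<^sub>M N" for f
    using that real_mask_measurable unfolding sec by (subst distr_distr) (auto simp: comp_def)
  have view_eq: "view n \<pi> S (x, real_mask n t) = view n \<pi> S (x', real_mask n (?\<sigma> t))" if t: "t \<in> ?T" for t
  proof -
    have "(int (L (x i)) + t i) mod m = (int (L (x' i)) + ?\<sigma> t i) mod m" if "i \<in> {1..n} - S" for i
      using that \<delta>(2)[OF that] by (simp add: shift_mask_def mod_add_right_eq add.commute)
    moreover have "(\<Sum>i\<in>{1..n} - S. t i) mod m = (\<Sum>i\<in>{1..n} - S. ?\<sigma> t i) mod m" if "card S \<le> D"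
    proof -
      have "(\<Sum>i\<in>{1..n} - S. ?\<sigma> t i) mod m = (\<Sum>i\<in>{1..n} - S. t i + \<delta> i) mod m"
        by (simp add: shift_mask_def mod_sum_eq)
      then show ?thesis
        using \<delta>(3)[OF that] by (auto simp: sum.distrib elim!: dvdE)
    qed
    ultimately show ?thesis
      by (auto simp: view_def message_def \<pi>_def masking_protocol_def real_mask_def restrict_def fun_eq_iff)
  qed
  have "distr (secrets \<pi>) N (\<lambda>\<theta>. view n \<pi> S (x, \<theta>))
      = distr (measure_pmf ?p) N (\<lambda>t. view n \<pi> S (x', real_mask n (?\<sigma> t)))"
    unfolding law[OF meas(1)]
  proof (rule distr_cong_AE)
    show "AE t in measure_pmf ?p. view n \<pi> S (x, real_mask n t) = view n \<pi> S (x', real_mask n (?\<sigma> t))"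
      using ne finite_zero_sum_masks by (auto simp: AE_measure_pmf_iff view_eq)
  qed (use measurable_space[OF meas(1)] measurable_space[OF meas(2)] in
      \<open>auto simp: sec real_mask_def space_PiM\<close>)
  also have "\<dots> = distr (measure_pmf (map_pmf ?\<sigma> ?p)) N (\<lambda>t. view n \<pi> S (x', real_mask n t))"
    using measurable_space[OF meas(2)] unfolding map_pmf_rep_eq
    by (subst distr_distr) (auto simp: comp_def sec real_mask_def space_PiM)
  also have "map_pmf ?\<sigma> ?p = ?p"
    using bij_betw_shift_mask[OF \<open>0 < m\<close> \<delta>(1)] ne finite_zero_sum_masks by (rule map_pmf_of_set_bij_betw)
  finally show ?thesis unfolding law[OF meas(2)] .
qed

lemma masking_kernel_eq:
  fixes n d D K a and m :: int
  defines "\<pi> \<equiv> masking_protocol n d D m (linear_form K a)"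
  assumes "0 < m" and S: "S \<subseteq> {1..n}"
    and sum: "card S \<le> D \<Longrightarrow> aggregate ({1..n} - S) x = aggregate ({1..n} - S) x'"
    and meas: "(\<lambda>\<theta>. view n \<pi> S (x, \<theta>)) \<in> secrets \<pi> \<rightarrow>\<^sub>M N" "(\<lambda>\<theta>. view n \<pi> S (x', \<theta>)) \<in> secrets \<pi> \<rightarrow>\<^sub>M N"
  shows "distr (secrets \<pi>) N (\<lambda>\<theta>. view n \<pi> S (x, \<theta>)) = distr (secrets \<pi>) N (\<lambda>\<theta>. view n \<pi> S (x', \<theta>))"
proof -
  let ?L = "linear_form K a"
  define e where "e i = int (?L (x i)) - int (?L (x' i))" for i
  define s where "s = (SOME s. s \<in> S)"
  define \<delta> where "\<delta> i = (if i \<notin> S then e i else if i = s then - (\<Sum>i\<in>{1..n} - S. e i) else 0)" for i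
  have "(\<Sum>i\<in>{1..n} - S. e i)
      = int (?L (aggregate ({1..n} - S) x)) - int (?L (aggregate ({1..n} - S) x'))"
    by (simp add: e_def sum_subtractf linear_form_aggregate)
  then have zero: "card S \<le> D \<Longrightarrow> (\<Sum>i\<in>{1..n} - S. e i) = 0"
    using sum by simp
  have finS: "finite S" using S finite_subset by blast
  have survivors: "(\<Sum>i\<in>{1..n} - S. \<delta> i) = (\<Sum>i\<in>{1..n} - S. e i)"
    by (intro sum.cong) (auto simp: \<delta>_def)
  have dropouts: "(\<Sum>i\<in>S. \<delta> i) = - (\<Sum>i\<in>{1..n} - S. e i)"
  proof (cases "S = {}")
    case True
    then show ?thesis using zero by simp
  next
    case False
    then have "s \<in> S" unfolding s_def by (simp add: some_in_eq)
    have "(\<Sum>i\<in>S. \<delta> i) = (\<Sum>i\<in>S. if i = s then - (\<Sum>i\<in>{1..n} - S. e i) else 0)"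
      by (intro sum.cong) (auto simp: \<delta>_def)
    also have "\<dots> = - (\<Sum>i\<in>{1..n} - S. e i)"
      using \<open>s \<in> S\<close> finS by simp
    finally show ?thesis .
  qed
  have "(\<Sum>i\<in>{1..n}. \<delta> i) = 0"
    using sum.subset_diff[OF S, of \<delta>] survivors dropouts by simp
  then show ?thesis
    using meas \<open>0 < m\<close> zero survivors unfolding \<pi>_def
    by (intro masking_view_law_eq[where \<delta> = \<delta>]) (auto simp: \<delta>_def e_def)
qed

lemma secure_masking:
  fixes n d D K a and m :: int
  defines "\<pi> \<equiv> masking_protocol n d D m (linear_form K a)"
  assumes "0 < m"
  shows "secure_given_sum n d \<pi>" "secure_beyond_tolerance n d D \<pi>"
proof -
  have ker: "finite_channel.kernel (secrets \<pi>) (view_space n S) (view n \<pi> S) x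
      = finite_channel.kernel (secrets \<pi>) (view_space n S) (view n \<pi> S) x'"
    if P: "P \<in> data_laws n d" and S: "S \<subseteq> {1..n}"
      and x: "x \<in> user_data d {1..n}" "x' \<in> user_data d {1..n}"
      and sum: "card S \<le> D \<Longrightarrow> aggregate ({1..n} - S) x = aggregate ({1..n} - S) x'" for P S x x'
  proof -
    interpret finite_channel P "secrets \<pi>" "user_data d {1..n}" "view_space n S" "view n \<pi> S"
      unfolding \<pi>_def by (intro finite_channel_view aggregation_protocol_masking P S)
    show ?thesis
      using V_Pair[OF x(1)] V_Pair[OF x(2)] unfolding kernel_def unfolding \<pi>_def
      by (intro masking_kernel_eq[OF \<open>0 < m\<close> S sum]) auto
  qed
  have prot: "aggregation_protocol n d \<pi>" unfolding \<pi>_def by (rule aggregation_protocol_masking)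
  show "secure_given_sum n d \<pi>"
    unfolding secure_given_sum_def
  proof (intro ballI allI impI)
    fix P S assume P: "P \<in> data_laws n d" and S: "S \<subseteq> {1..n}"
    interpret finite_channel P "secrets \<pi>" "user_data d {1..n}" "view_space n S" "view n \<pi> S"
      by (intro finite_channel_view prot P S)
    show "prob_space.conditional_mutual_information (joint_law \<pi> P) 2 (view_space n S)
        (count_space (user_data d ({1..n} - S))) (count_space UNIV)
        (view n \<pi> S) (surviving_data n S) (surviving_sum n S) = 0"
      unfolding joint_law_def
      by (rule conditional_mutual_information_eq_0[of "\<lambda>x. restrict x ({1..n} - S)" _
            "aggregate ({1..n} - S)"]) (auto intro!: ker[OF P S] simp del: One_nat_def)
  qed
  show "secure_beyond_tolerance n d D \<pi>"
    unfolding secure_beyond_tolerance_def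
  proof (intro ballI allI impI)
    fix P S assume P: "P \<in> data_laws n d" and S: "S \<subseteq> {1..n}" and card: "card S > D"
    interpret finite_channel P "secrets \<pi>" "user_data d {1..n}" "view_space n S" "view n \<pi> S"
      by (intro finite_channel_view prot P S)
    show "prob_space.mutual_information (joint_law \<pi> P) 2 (view_space n S)
        (count_space (user_data d ({1..n} - S))) (view n \<pi> S) (surviving_data n S) = 0"
      unfolding joint_law_def
      by (rule mutual_information_eq_0[of "\<lambda>x. restrict x ({1..n} - S)"])
        (use card in \<open>auto intro!: ker[OF P S] simp del: One_nat_def\<close>)
  qed
qed

lemma AE_masking_secrets:
  fixes n d D L and m :: int
  defines "\<pi> \<equiv> masking_protocol n d D m L"
  assumes "0 < m" and P: "P \<in> data_laws n d"
  shows "AE \<omega> in joint_law \<pi> P. fst \<omega> \<in> user_data d {1..n} \<and> snd \<omega> \<in> real_mask n ` zero_sum_masks n m"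
proof -
  let ?G = "real_mask n ` zero_sum_masks n m"
  have prot: "aggregation_protocol n d \<pi>" unfolding \<pi>_def by (rule aggregation_protocol_masking)
  interpret finite_channel P "secrets \<pi>" "user_data d {1..n}" "view_space n {}" "view n \<pi> {}"
    by (intro finite_channel_view prot P) simp
  have "{\<theta>} \<in> sets (Pi\<^sub>M {1..n} (\<lambda>_. borel))" if "\<theta> \<in> ?G" for \<theta> :: "nat \<Rightarrow> real"
  proof -
    have "\<theta> \<in> extensional {1..n}" using that by (auto simp: real_mask_def)
    then have "{\<theta>} = (\<Pi>\<^sub>E i\<in>{1..n}. {\<theta> i})" by (rule PiE_singleton[symmetric])
    also have "\<dots> \<in> sets (Pi\<^sub>M {1..n} (\<lambda>_. borel))" by (rule sets_PiM_I_finite) auto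
    finally show ?thesis .
  qed
  then have G: "?G \<in> sets (Pi\<^sub>M {1..n} (\<lambda>_. borel))"
    using sets.finite_UN[of ?G "\<lambda>\<theta>. {\<theta>}"] finite_zero_sum_masks by simp
  have sec: "secrets \<pi> = distr (measure_pmf (pmf_of_set (zero_sum_masks n m))) (Pi\<^sub>M {1..n} (\<lambda>_. borel)) (real_mask n)"
    by (simp add: \<pi>_def masking_protocol_def)
  then have sets: "sets (secrets \<pi>) = sets (Pi\<^sub>M {1..n} (\<lambda>_. borel))" by simp
  have "AE \<theta> in secrets \<pi>. \<theta> \<in> ?G"
  proof -
    have "{\<theta> \<in> space (Pi\<^sub>M {1..n} (\<lambda>_. borel)). \<theta> \<in> ?G} = ?G"
      using sets.sets_into_space[OF G] by auto
    then have "{\<theta> \<in> space (Pi\<^sub>M {1..n} (\<lambda>_. borel)). \<theta> \<in> ?G} \<in> sets (Pi\<^sub>M {1..n} (\<lambda>_. borel))"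
      using G by simp
    then show ?thesis
      unfolding sec AE_distr_iff[OF real_mask_measurable]
      using zero_sum_masks_nonempty[OF \<open>0 < m\<close>] finite_zero_sum_masks
      by (simp add: AE_measure_pmf_iff AE_distr_iff[OF real_mask_measurable])
  qed
  then have "AE \<omega> in P \<Otimes>\<^sub>M secrets \<pi>. snd \<omega> \<in> ?G"
    using G unfolding sets[symmetric]
    by (intro J.AE_pair_measure) auto
  then show ?thesis
    unfolding joint_law_def using AE_space
    by eventually_elim (auto simp: space_pair_measure space_P)
qed

lemma mod_sum_diff_eq:
  fixes f :: "'b \<Rightarrow> int"
  shows "((\<Sum>i\<in>A. f i mod m) - r mod m) mod m = ((\<Sum>i\<in>A. f i) - r) mod m"
proof -
  have "((\<Sum>i\<in>A. f i mod m) - r mod m) mod m = ((\<Sum>i\<in>A. f i mod m) mod m - r) mod m"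
    by (simp only: mod_diff_left_eq mod_diff_right_eq)
  also have "\<dots> = ((\<Sum>i\<in>A. f i) mod m - r) mod m" by (simp only: mod_sum_eq)
  also have "\<dots> = ((\<Sum>i\<in>A. f i) - r) mod m" by (rule mod_diff_left_eq)
  finally show ?thesis .
qed

lemma correct_masking:
  fixes n d D a B
  defines "L \<equiv> linear_form {1..d} a"
  assumes a: "a \<in> {1..d} \<rightarrow> {..<B}" and inj: "inj_on L (histograms n d)"
  shows "correct n d D (masking_protocol n d D (int (n * B + 1)) L)"
  unfolding correct_def
proof (intro ballI allI impI)
  let ?m = "int (n * B + 1)" let ?\<pi> = "masking_protocol n d D ?m L"
  fix P S assume P: "P \<in> data_laws n d" and S: "S \<subseteq> {1..n}" and card: "card S \<le> D"
  have dec_eq: "dec ?\<pi> S (view n ?\<pi> S (x, \<theta>)) = aggregate ({1..n} - S) x"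
    if x: "x \<in> user_data d {1..n}" and \<theta>: "\<theta> \<in> real_mask n ` zero_sum_masks n ?m" for x \<theta>
  proof -
    obtain t where t: "t \<in> zero_sum_masks n ?m" and \<theta>_eq: "\<theta> = real_mask n t" using \<theta> by blast
    let ?A = "{1..n} - S" let ?u = "aggregate ?A x"
    have u: "?u \<in> histograms n d"
      using x by (intro aggregate_in_histograms) auto
    have "L ?u \<le> (\<Sum>i\<in>?A. B)"
      unfolding L_def linear_form_aggregate
      using x a by (intro sum_mono less_imp_le linear_form_one_hot) auto
    also have "\<dots> \<le> n * B"
      using card_mono[of "{1..n}" ?A] by (simp add: mult_le_mono1)
    finally have less: "int (L ?u) < ?m" by linarith
    have rev: "\<lfloor>snd (view n ?\<pi> S (x, \<theta>))\<rfloor> = (\<Sum>i\<in>?A. t i) mod ?m"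
    proof (cases "S = {}")
      case True
      then show ?thesis using t by (simp add: view_def zero_sum_masks_def)
    next
      case False
      then show ?thesis
        using card by (simp add: view_def masking_protocol_def \<theta>_eq real_mask_def)
    qed
    have "(\<Sum>i\<in>?A. int (fst (view n ?\<pi> S (x, \<theta>)) i)) = (\<Sum>i\<in>?A. (int (L (x i)) + t i) mod ?m)"
    proof -
      have "0 \<le> z mod ?m" for z by (rule pos_mod_sign) (simp add: add_pos_nonneg)
      then show ?thesis
        by (intro sum.cong refl) (simp add: view_def message_def masking_protocol_def \<theta>_eq real_mask_def del: of_nat_add of_nat_mult of_nat_Suc)
    qed
    then have "((\<Sum>i\<in>?A. int (fst (view n ?\<pi> S (x, \<theta>)) i)) - \<lfloor>snd (view n ?\<pi> S (x, \<theta>))\<rfloor>) mod ?m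
        = ((\<Sum>i\<in>?A. int (L (x i)) + t i) - (\<Sum>i\<in>?A. t i)) mod ?m"
      unfolding rev by (simp only: mod_sum_diff_eq)
    also have "\<dots> = int (L ?u) mod ?m"
      by (simp add: sum.distrib L_def linear_form_aggregate)
    also have "\<dots> = int (L ?u)"
      using less by simp
    finally have "dec ?\<pi> S (view n ?\<pi> S (x, \<theta>)) = inv_into (histograms n d) L (L ?u)"
      by (simp add: masking_protocol_def case_prod_unfold)
    then show ?thesis using inv_into_f_f[OF inj u] by simp
  qed
  have "0 < n * B + 1" by simp
  then have "0 < ?m" by (rule of_nat_0_less_iff[THEN iffD2])
  then have "AE \<omega> in joint_law ?\<pi> P. fst \<omega> \<in> user_data d {1..n} \<and> snd \<omega> \<in> real_mask n ` zero_sum_masks n ?m"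
    by (rule AE_masking_secrets[OF _ P])
  then show "AE \<omega> in joint_law ?\<pi> P. dec ?\<pi> S (view n ?\<pi> S \<omega>) = surviving_sum n S \<omega>"
    by eventually_elim (metis dec_eq prod.collapse)
qed

lemma (in prob_space) entropy_bits_le:
  assumes Y: "Y \<in> M \<rightarrow>\<^sub>M count_space UNIV" and range: "Y ` space M \<subseteq> {..<m}"
  shows "entropy_bits M Y \<le> ennreal (log 2 (real m))"
proof -
  interpret information_space M 2 by standard simp
  have sf: "simple_function M Y"
    using Y range finite_subset[OF range] by (auto simp: simple_function_def)
  have "entropy 2 (count_space (Y ` space M)) Y \<le> log 2 (real (card (Y ` space M)))"
    by (rule entropy_le_card, rule simple_distributedI[OF sf]) auto
  also have "\<dots> \<le> log 2 (real m)"
  proof -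
    have "0 < card (Y ` space M)" "card (Y ` space M) \<le> m"
      using card_mono[OF _ range] not_empty finite_subset[OF range] by (auto simp: card_gt_0_iff)
    then show ?thesis by simp
  qed
  finally show ?thesis
    unfolding entropy_bits_simple[OF sf] by (rule ennreal_leI)
qed

lemma prob_space_joint_law:
  "aggregation_protocol n d \<pi> \<Longrightarrow> P \<in> data_laws n d \<Longrightarrow> prob_space (joint_law \<pi> P)"
  unfolding joint_law_def aggregation_protocol_def data_laws_def
  by (simp add: prob_algebra_iff prob_space_pair)

lemma communication_cost_masking_le:
  assumes i: "i \<in> {1..n}" and "0 < m"
  shows "communication_cost n d (masking_protocol n d D (int m) L) i \<le> ennreal (log 2 (real m))"
  unfolding communication_cost_def
proof (rule SUP_least)
  let ?\<pi> = "masking_protocol n d D (int m) L"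
  fix P assume P: "P \<in> data_laws n d"
  note prot = aggregation_protocol_masking[of n d D "int m" L]
  interpret prob_space "joint_law ?\<pi> P" using prot P by (rule prob_space_joint_law)
  show "entropy_bits (joint_law ?\<pi> P) (message ?\<pi> i) \<le> ennreal (log 2 (real m))"
    using \<open>0 < m\<close>
    by (intro entropy_bits_le message_measurable[OF prot P i])
      (auto simp: message_def masking_protocol_def nat_less_iff)
qed

lemma secure_histogram_protocol_exists:
  assumes n: "n \<ge> 1" "n \<le> d" and d: "d \<ge> 2"
  shows "\<exists>\<pi>. secure_histogram_protocol n d D \<pi> \<and>
    (\<forall>i\<in>{1..n}. communication_cost n d \<pi> i \<le> ennreal (6 * real n * log 2 (real d)))"
proof -
  define B where "B = ((d + 1) ^ n)\<^sup>2 + 1"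
  define m where "m = n * B + 1"
  have supp: "u k = 0" if "u \<in> histograms n d" "k \<notin> {1..d}" for u k
  proof -
    obtain A x where x: "x \<in> user_data d A" and u: "u = aggregate A x"
      using \<open>u \<in> histograms n d\<close> by (auto simp: histograms_def)
    have "x i k = 0" if i: "i \<in> A" for i
    proof -
      obtain j where "j \<in> {1..d}" "x i = unit_vector j"
        using PiE_mem[OF x i] by (auto simp: one_hot_def)
      with \<open>k \<notin> {1..d}\<close> show ?thesis by (auto simp: unit_vector_def)
    qed
    then show ?thesis by (simp add: u aggregate_def)
  qed
  have "(card (histograms n d))\<^sup>2 \<le> ((d + 1) ^ n)\<^sup>2"
    by (intro power_mono card_histograms_le) simp
  then have "(card (histograms n d))\<^sup>2 < B"
    unfolding B_def by linarith
  then have "\<exists>a\<in>{1..d} \<rightarrow>\<^sub>E {..<B}. inj_on (linear_form {1..d} a) (histograms n d)"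
    using supp by (intro injective_linear_form_exists finite_histograms) auto
  then obtain a where a: "a \<in> {1..d} \<rightarrow>\<^sub>E {..<B}" and inj: "inj_on (linear_form {1..d} a) (histograms n d)"
    by auto
  let ?\<pi> = "masking_protocol n d D (int m) (linear_form {1..d} a)"
  have "0 < m" unfolding m_def by simp
  then have pos: "0 < int m" by simp
  have "correct n d D ?\<pi>"
    unfolding m_def using a inj by (intro correct_masking) auto
  then have secure: "secure_histogram_protocol n d D ?\<pi>"
    unfolding secure_histogram_protocol_def
    using aggregation_protocol_masking secure_masking[OF pos] by blast
  have "d + 1 \<le> d\<^sup>2" using d by (auto simp: power2_eq_square intro: order_trans[of _ "2 * d"])
  have "B \<le> d ^ (4 * n) + 1"
  proof -
    have "((d + 1) ^ n)\<^sup>2 = (d + 1) ^ (2 * n)" by (simp add: power_mult mult.commute)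
    also have "\<dots> \<le> (d\<^sup>2) ^ (2 * n)" using \<open>d + 1 \<le> d\<^sup>2\<close> by (intro power_mono) auto
    finally show ?thesis unfolding B_def by (simp flip: power_mult)
  qed
  then have "m \<le> d * (d ^ (4 * n) + 1) + 1"
    unfolding m_def using n by (intro add_mono mult_mono order_refl) auto
  also have "\<dots> \<le> d * d ^ (4 * n) + d\<^sup>2" using \<open>d + 1 \<le> d\<^sup>2\<close> by simp
  also have "\<dots> \<le> d * d ^ (4 * n) + d * d ^ (4 * n)"
  proof -
    have "d ^ 1 \<le> d ^ (4 * n)" using n d by (intro power_increasing) auto
    then show ?thesis by (simp add: power2_eq_square)
  qed
  also have "\<dots> \<le> d * (d * d ^ (4 * n))"
    using mult_le_mono1[OF d, of "d * d ^ (4 * n)"] by (simp only: mult_2)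
  also have "\<dots> = d ^ (4 * n + 2)" by simp
  also have "\<dots> \<le> d ^ (6 * n)" using n d by (intro power_increasing) auto
  finally have "m \<le> d ^ (6 * n)" .
  then have "real m \<le> real (d ^ (6 * n))" by (rule of_nat_mono)
  then have "real m \<le> real d ^ (6 * n)" by simp
  then have "log 2 (real m) \<le> log 2 (real d ^ (6 * n))"
    using \<open>0 < m\<close> d by (subst log_le_cancel_iff) auto
  also have "\<dots> = 6 * real n * log 2 (real d)"
    using d by (simp add: log_nat_power)
  finally have "log 2 (real m) \<le> 6 * real n * log 2 (real d)" .
  then have "communication_cost n d ?\<pi> i \<le> ennreal (6 * real n * log 2 (real d))"
    if "i \<in> {1..n}" for i
    using communication_cost_masking_le[OF that, of m d D "linear_form {1..d} a"]
    by (auto simp: m_def intro: order_trans ennreal_leI)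
  with secure show ?thesis by blast
qed

section \<open>The lower bound\<close>

lemma (in prob_space) min_entropy_le_entropy_bits:
  assumes Y[measurable]: "Y \<in> M \<rightarrow>\<^sub>M count_space UNIV" and K: "1 \<le> K"
    and le: "\<And>y. measure M (Y -` {y} \<inter> space M) \<le> 1 / K"
  shows "ennreal (log 2 K) \<le> entropy_bits M Y"
proof -
  let ?p = "\<lambda>y. measure M (Y -` {y} \<inter> space M)"
  have "(\<Sum>y. emeasure M (Y -` {y} \<inter> space M)) = emeasure M (\<Union>y. Y -` {y} \<inter> space M)"
    by (rule suminf_emeasure) (auto simp: disjoint_family_on_def)
  also have "(\<Union>y. Y -` {y} \<inter> space M) = space M" by auto
  finally have total: "(\<Sum>y. ennreal (?p y)) = 1"
    unfolding emeasure_eq_measure by (simp add: prob_space)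
  have "?p y * log 2 K \<le> - (?p y * log 2 (?p y))" for y
  proof (cases "?p y = 0")
    case False
    then have pos: "0 < ?p y" by (simp add: zero_less_measure_iff)
    then have "log 2 (?p y) \<le> log 2 (1 / K)"
      using le[of y] K by simp
    also have "\<dots> = - log 2 K"
      using K by (simp add: log_divide)
    finally show ?thesis
      using pos mult_left_mono[of "log 2 (?p y)" "- log 2 K" "?p y"] by simp
  qed simp
  then have "(\<Sum>y. ennreal (log 2 K) * ennreal (?p y)) \<le> entropy_bits M Y"
    unfolding entropy_bits_def using K
    by (intro suminf_le summableI) (simp add: ennreal_leI mult.commute flip: ennreal_mult)
  then show ?thesis
    unfolding ennreal_suminf_cmult total by simp
qed

definition data_law :: "nat \<Rightarrow> nat \<Rightarrow> (nat \<Rightarrow> nat \<Rightarrow> nat) pmf \<Rightarrow> (nat \<Rightarrow> nat \<Rightarrow> nat) measure" where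
  "data_law n d p = restrict_space (measure_pmf p) (user_data d {1..n})"

lemma emeasure_data_law:
  "B \<subseteq> user_data d {1..n} \<Longrightarrow> emeasure (data_law n d p) B = emeasure (measure_pmf p) B"
  unfolding data_law_def by (rule emeasure_restrict_space) auto

lemma data_law_in:
  assumes "set_pmf p \<subseteq> user_data d {1..n}"
  shows "data_law n d p \<in> data_laws n d"
proof -
  have "space (data_law n d p) = user_data d {1..n}"
    by (simp add: data_law_def space_restrict_space)
  moreover have "emeasure (measure_pmf p) (user_data d {1..n}) = 1"
    using assms by (simp add: measure_pmf.emeasure_eq_1_AE AE_measure_pmf_iff subset_iff)
  ultimately have "prob_space (data_law n d p)"
    by (intro prob_spaceI) (simp add: emeasure_data_law)
  moreover have "sets (data_law n d p) = sets (count_space (user_data d {1..n}))"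
    by (auto simp: data_law_def sets_restrict_space)
  ultimately show ?thesis
    by (simp add: data_laws_def prob_algebra_iff)
qed

definition transcript_law ::
  "protocol \<Rightarrow> nat set \<Rightarrow> (nat \<Rightarrow> nat \<Rightarrow> nat) \<Rightarrow> (nat \<Rightarrow> nat) measure" where
  "transcript_law \<pi> A x = distr (secrets \<pi>) (Pi\<^sub>M A (\<lambda>_. count_space UNIV)) (\<lambda>\<theta>. \<lambda>i\<in>A. enc \<pi> i (x i) (\<theta> i))"

lemma transcript_measurable:
  assumes \<pi>: "aggregation_protocol n d \<pi>" and A: "A \<subseteq> {1..n}" and x: "x \<in> A \<rightarrow> one_hot d"
  shows "(\<lambda>\<theta>. \<lambda>i\<in>A. enc \<pi> i (x i) (\<theta> i)) \<in> secrets \<pi> \<rightarrow>\<^sub>M Pi\<^sub>M A (\<lambda>_. count_space UNIV)"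
proof (rule measurable_restrict)
  fix i assume i: "i \<in> A"
  have sets: "sets (secrets \<pi>) = sets (Pi\<^sub>M {1..n} (\<lambda>_. borel))"
    using \<pi> by (auto simp: aggregation_protocol_def prob_algebra_iff)
  have "enc \<pi> i (x i) \<in> borel \<rightarrow>\<^sub>M count_space UNIV"
    using \<pi> A x i by (auto simp: aggregation_protocol_def)
  moreover have "(\<lambda>\<theta>. \<theta> i) \<in> secrets \<pi> \<rightarrow>\<^sub>M borel"
    unfolding measurable_cong_sets[OF sets refl] using A i by (intro measurable_component_singleton) auto
  ultimately show "(\<lambda>\<theta>. enc \<pi> i (x i) (\<theta> i)) \<in> secrets \<pi> \<rightarrow>\<^sub>M count_space UNIV"
    by (rule measurable_compose[rotated])
qed

lemma transcript_law_restrict: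
  assumes \<pi>: "aggregation_protocol n d \<pi>" and A: "A \<subseteq> {1..n}" and x: "x \<in> {1..n} \<rightarrow> one_hot d"
  shows "transcript_law \<pi> A x
    = distr (transcript_law \<pi> {1..n} x) (Pi\<^sub>M A (\<lambda>_. count_space UNIV)) (\<lambda>y. restrict y A)"
  unfolding transcript_law_def
  by (subst distr_distr[OF measurable_restrict_subset[OF A] transcript_measurable[OF \<pi> subset_refl x]])
    (use A in \<open>auto simp: comp_def fun_eq_iff restrict_def subset_iff simp del: One_nat_def intro!: distr_cong\<close>)

lemma transcript_law_cong:
  "(\<And>i. i \<in> A \<Longrightarrow> x i = y i) \<Longrightarrow> transcript_law \<pi> A x = transcript_law \<pi> A y"
  unfolding transcript_law_def by (intro distr_cong refl restrict_ext) simp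

text \<open>Security (S1) without dropouts, for data uniform on \<open>{x, x'}\<close>; the sum is then constant.\<close>

lemma transcript_law_eq_of_aggregate_eq:
  assumes \<pi>: "aggregation_protocol n d \<pi>" and sec: "secure_given_sum n d \<pi>"
    and x: "x \<in> user_data d {1..n}" "x' \<in> user_data d {1..n}"
    and sum: "aggregate {1..n} x = aggregate {1..n} x'"
  shows "transcript_law \<pi> {1..n} x = transcript_law \<pi> {1..n} x'"
proof -
  define P where "P = data_law n d (pmf_of_set {x, x'})"
  have P: "P \<in> data_laws n d"
    unfolding P_def using x by (intro data_law_in) auto
  interpret finite_channel P "secrets \<pi>" "user_data d {1..n}" "view_space n {}" "view n \<pi> {}"
    by (intro finite_channel_view \<pi> P) simp
  let ?MX = "count_space (user_data d ({1..n} - {}))" and ?MZ = "count_space UNIV :: (nat \<Rightarrow> nat) measure"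
  let ?X = "\<lambda>x. restrict x ({1..n} - {})" and ?Z = "aggregate ({1..n} - {})"
  have "prob_space.conditional_mutual_information (joint_law \<pi> P) 2
      (view_space n {}) ?MX ?MZ (view n \<pi> {}) (surviving_data n {}) (surviving_sum n {}) = 0"
    using sec P unfolding secure_given_sum_def by blast
  then have "J.mutual_information 2 (view_space n {}) (?MX \<Otimes>\<^sub>M ?MZ) (view n \<pi> {}) (\<lambda>\<omega>. (?X (fst \<omega>), ?Z (fst \<omega>)))
      - J.mutual_information 2 (view_space n {}) ?MZ (view n \<pi> {}) (\<lambda>\<omega>. ?Z (fst \<omega>)) = 0"
    unfolding joint_law_def J.conditional_mutual_information_def .
  moreover have "J.mutual_information 2 (view_space n {}) ?MZ (view n \<pi> {}) (\<lambda>\<omega>. ?Z (fst \<omega>)) = 0"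
  proof (rule mutual_information_AE_const)
    have "{y \<in> user_data d {1..n}. ?Z y \<noteq> ?Z x} \<in> null_sets P"
      using sum unfolding P_def
      by (auto simp: null_sets_def sets_P[unfolded P_def] emeasure_data_law
          measure_pmf.emeasure_eq_measure measure_pmf_zero_iff)
    then show "AE y in P. ?Z y = ?Z x"
      by (rule AE_I') (auto simp: space_P)
  qed simp
  ultimately have MI: "J.mutual_information 2 (view_space n {}) (?MX \<Otimes>\<^sub>M ?MZ) (view n \<pi> {})
      (\<lambda>\<omega>. (?X (fst \<omega>), ?Z (fst \<omega>))) = 0"
    by simp
  have kernel: "kernel y = marginal" if y: "y \<in> {x, x'}" for y
  proof (rule kernel_eq_marginal[OF _ _ _ _ MI])
    have yU: "y \<in> user_data d {1..n}" using x y by auto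
    then show "y \<in> user_data d {1..n}" .
    show "(\<lambda>x. (?X x, ?Z x)) \<in> user_data d {1..n} \<rightarrow> space (?MX \<Otimes>\<^sub>M ?MZ)"
      by (auto simp: space_pair_measure)
    have "{?X y} \<in> sets ?MX" using yU by auto
    then have "{?X y} \<times> {?Z y} \<in> sets (?MX \<Otimes>\<^sub>M ?MZ)" by (intro pair_measureI) auto
    then show "{(?X y, ?Z y)} \<in> sets (?MX \<Otimes>\<^sub>M ?MZ)" by simp
    show "z = y" if "z \<in> user_data d {1..n}" "(?X z, ?Z z) = (?X y, ?Z y)" for z
      using that yU by (simp add: PiE_restrict)
    show "emeasure P {y} \<noteq> 0"
      using y yU unfolding P_def
      by (subst emeasure_data_law) (auto simp: emeasure_pmf_single)
  qed simp
  have "transcript_law \<pi> {1..n} y = distr (kernel y) (Pi\<^sub>M {1..n} (\<lambda>_. count_space UNIV)) fst"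
    if "y \<in> user_data d {1..n}" for y
    unfolding kernel_def transcript_law_def using V_Pair[OF that]
    by (subst distr_distr) (auto simp: comp_def view_def message_def)
  then show ?thesis using kernel x by simp
qed

text \<open>
  A message outside \<open>A\<close> is free, so one coordinate in \<open>A\<close> can be traded against it without
  changing the sum.
\<close>

lemma transcript_law_update:
  assumes \<pi>: "aggregation_protocol n d \<pi>" and sec: "secure_given_sum n d \<pi>"
    and A: "A \<subseteq> {1..n}" and i: "i \<in> {1..n} - A" and j: "j \<in> A"
    and x: "x \<in> user_data d {1..n}" and v: "v \<in> one_hot d"
  shows "transcript_law \<pi> A (x(j := v)) = transcript_law \<pi> A x"
proof -
  define y where "y = x(i := v)"
  define y' where "y' = x(i := x j, j := v)"
  have ij: "i \<noteq> j" "i \<in> {1..n}" "j \<in> {1..n}" using A i j by auto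
  have y: "y \<in> user_data d {1..n}" "y' \<in> user_data d {1..n}"
    using x v ij unfolding y_def y'_def by (auto simp: PiE_iff extensional_def)
  have split: "(\<Sum>l\<in>{1..n}. z l k) = z i k + (z j k + (\<Sum>l\<in>{1..n} - {i} - {j}. z l k))"
    for z :: "nat \<Rightarrow> nat \<Rightarrow> nat" and k
    using ij sum.remove[of "{1..n}" i "\<lambda>l. z l k"] sum.remove[of "{1..n} - {i}" j "\<lambda>l. z l k"] by simp
  have "aggregate {1..n} y = aggregate {1..n} y'"
    unfolding aggregate_def split y_def y'_def using ij by (auto simp: fun_eq_iff intro!: sum.cong)
  then have eq: "transcript_law \<pi> {1..n} y = transcript_law \<pi> {1..n} y'"
    using \<pi> sec y by (intro transcript_law_eq_of_aggregate_eq)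
  have "transcript_law \<pi> A (x(j := v)) = transcript_law \<pi> A y'"
    using i unfolding y'_def by (intro transcript_law_cong) auto
  also have "\<dots> = transcript_law \<pi> A y"
    using y eq by (simp add: transcript_law_restrict[OF \<pi> A] PiE_def)
  also have "\<dots> = transcript_law \<pi> A x"
    using i unfolding y_def by (intro transcript_law_cong) auto
  finally show ?thesis .
qed

lemma transcript_law_const:
  assumes \<pi>: "aggregation_protocol n d \<pi>" and sec: "secure_given_sum n d \<pi>"
    and A: "A \<subseteq> {1..n}" and i: "i \<in> {1..n} - A"
    and x: "x \<in> user_data d {1..n}" "x' \<in> user_data d {1..n}"
  shows "transcript_law \<pi> A x = transcript_law \<pi> A x'"
proof -
  have "finite A" using A finite_subset by blast
  have "transcript_law \<pi> A (override_on x x' B) = transcript_law \<pi> A x"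
    if "finite B" "B \<subseteq> A" for B
    using that
  proof (induction B)
    case (insert j B)
    let ?z = "override_on x x' B"
    have "override_on x x' (insert j B) = ?z(j := x' j)"
      by (auto simp: override_on_def)
    moreover have "?z \<in> user_data d {1..n}"
      using x by (auto simp: override_on_def PiE_iff extensional_def)
    moreover have "x' j \<in> one_hot d"
      using insert.prems A x by (auto dest: PiE_mem)
    ultimately have "transcript_law \<pi> A (override_on x x' (insert j B)) = transcript_law \<pi> A ?z"
      using insert.prems by (simp add: transcript_law_update[OF \<pi> sec A i])
    then show ?case using insert by simp
  qed simp
  from this[OF \<open>finite A\<close> subset_refl] show ?thesis
    by (metis override_on_apply_in transcript_law_cong)
qed

text \<open>Data vectors with the same histogram take their values among those of any one of them.\<close>

lemma card_user_data_le_aggregates: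
  assumes A: "finite A"
  shows "d ^ card A \<le> card (aggregate A ` user_data d A) * card A ^ card A"
proof -
  let ?U = "user_data d A"
  have fin: "finite ?U" by (rule finite_user_data[OF A])
  have fiber: "card {x \<in> ?U. aggregate A x = u} \<le> card A ^ card A" if u: "u \<in> aggregate A ` ?U" for u
  proof -
    obtain x0 where x0: "x0 \<in> ?U" "u = aggregate A x0" using u by blast
    have "{x \<in> ?U. aggregate A x = u} \<subseteq> A \<rightarrow>\<^sub>E x0 ` A"
    proof
      fix x assume "x \<in> {x \<in> ?U. aggregate A x = u}"
      then have x: "x \<in> ?U" and eq: "aggregate A x = u" by auto
      have "x i \<in> x0 ` A" if i: "i \<in> A" for i
      proof -
        obtain j where j: "x i = unit_vector j" using PiE_mem[OF x i] by (auto simp: one_hot_def)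
        have "1 \<le> (\<Sum>l\<in>A. x l j)"
          using member_le_sum[of i A "\<lambda>l. x l j"] A i by (simp add: j unit_vector_def)
        also have "\<dots> = (\<Sum>l\<in>A. x0 l j)"
          using fun_cong[OF eq, of j] x0(2) by (simp add: aggregate_def)
        finally have "(\<Sum>l\<in>A. x0 l j) \<noteq> 0" by simp
        then obtain l where l: "l \<in> A" "x0 l j \<noteq> 0" by (meson sum.neutral)
        obtain j' where "x0 l = unit_vector j'" using PiE_mem[OF x0(1) l(1)] by (auto simp: one_hot_def)
        with l(2) j have "x i = x0 l" by (auto simp: unit_vector_def split: if_splits)
        with l(1) show ?thesis by blast
      qed
      then show "x \<in> A \<rightarrow>\<^sub>E x0 ` A" using x by (auto simp: PiE_iff)
    qed
    then have "card {x \<in> ?U. aggregate A x = u} \<le> card (A \<rightarrow>\<^sub>E x0 ` A)"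
      using A by (intro card_mono finite_PiE) auto
    also have "\<dots> = card (x0 ` A) ^ card A" using A by (simp add: card_PiE)
    also have "\<dots> \<le> card A ^ card A" using A by (intro power_mono card_image_le) auto
    finally show ?thesis .
  qed
  have "d ^ card A = card ?U" using A by (simp add: card_PiE card_one_hot)
  also have "?U = (\<Union>u\<in>aggregate A ` ?U. {x \<in> ?U. aggregate A x = u})" by auto
  also have "card \<dots> \<le> (\<Sum>u\<in>aggregate A ` ?U. card {x \<in> ?U. aggregate A x = u})"
    using fin by (intro card_UN_le) auto
  also have "\<dots> \<le> (\<Sum>u\<in>aggregate A ` ?U. card A ^ card A)"
    by (rule sum_mono) (rule fiber)
  finally show ?thesis by simp
qed

lemma AE_secrets_correct:
  assumes \<pi>: "aggregation_protocol n d \<pi>" and corr: "correct n d D \<pi>" and x: "x \<in> user_data d {1..n}"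
  shows "AE \<theta> in secrets \<pi>. dec \<pi> {} (\<lambda>i\<in>{1..n}. enc \<pi> i (x i) (\<theta> i), 0) = aggregate {1..n} x"
proof -
  define P where "P = data_law n d (return_pmf x)"
  have P: "P \<in> data_laws n d"
    unfolding P_def using x by (intro data_law_in) simp
  interpret finite_channel P "secrets \<pi>" "user_data d {1..n}" "view_space n {}" "view n \<pi> {}"
    by (intro finite_channel_view \<pi> P) simp
  have "AE \<omega> in P \<Otimes>\<^sub>M secrets \<pi>. dec \<pi> {} (view n \<pi> {} \<omega>) = surviving_sum n {} \<omega>"
    using corr[unfolded correct_def joint_law_def, rule_format, OF P, of "{}"] by simp
  from J.AE_pair[OF this] have "AE y in P. AE \<theta> in secrets \<pi>. dec \<pi> {} (view n \<pi> {} (y, \<theta>)) = aggregate {1..n} y"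
    by simp
  then obtain N where N: "N \<in> null_sets P" "{y \<in> space P. \<not> (AE \<theta> in secrets \<pi>.
      dec \<pi> {} (view n \<pi> {} (y, \<theta>)) = aggregate {1..n} y)} \<subseteq> N"
    by (auto simp: eventually_ae_filter)
  have "x \<notin> N"
  proof
    assume "x \<in> N"
    then have "{x} \<in> null_sets P"
      using x by (intro null_sets_subset[OF N(1)]) (auto simp: sets_P)
    then have "emeasure P {x} = 0" by (rule null_setsD1)
    then show False
      using x unfolding P_def by (simp add: emeasure_data_law emeasure_pmf_single)
  qed
  with N(2) x have "AE \<theta> in secrets \<pi>. dec \<pi> {} (view n \<pi> {} (x, \<theta>)) = aggregate {1..n} x"
    by (auto simp: space_P)
  then show ?thesis by (simp add: view_def message_def)
qed

text \<open>
  Given the message \<open>y\<close> of user \<open>i\<close>, distinct sums of the other users' data need disjoint sets of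
  the other messages, whose law is the same for all data.
\<close>

lemma message_atom_le:
  assumes \<pi>: "aggregation_protocol n d \<pi>" and sec: "secure_given_sum n d \<pi>" and corr: "correct n d D \<pi>"
    and i: "i \<in> {1..n}" and x0: "x0 \<in> user_data d {1..n}"
  defines "A \<equiv> {1..n} - {i}"
  shows "measure (secrets \<pi>) {\<theta> \<in> space (secrets \<pi>). enc \<pi> i (x0 i) (\<theta> i) = y}
      * real (card (aggregate A ` user_data d A)) \<le> 1"
proof -
  let ?E = "{\<theta> \<in> space (secrets \<pi>). enc \<pi> i (x0 i) (\<theta> i) = y}"
  let ?N = "Pi\<^sub>M A (\<lambda>_. count_space (UNIV :: nat set))"
  interpret Q: prob_space "secrets \<pi>"
    using \<pi> by (auto simp: aggregation_protocol_def prob_algebra_iff)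
  have A: "A \<subseteq> {1..n}" "finite A" "i \<notin> A" "insert i A = {1..n}" using i unfolding A_def by auto
  have N: "?N = count_space (A \<rightarrow>\<^sub>E UNIV)"
    using A(2) by (rule count_space_PiM_finite) simp
  have meas: "(\<lambda>\<theta>. \<lambda>j\<in>A. enc \<pi> j (x j) (\<theta> j)) \<in> secrets \<pi> \<rightarrow>\<^sub>M ?N"
    if "x \<in> user_data d {1..n}" for x
    using that A(1) by (intro transcript_measurable[OF \<pi>]) auto
  interpret r: prob_space "transcript_law \<pi> A x0"
    unfolding transcript_law_def by (rule Q.prob_space_distr) (rule meas[OF x0])
  define G where "G u = {b \<in> A \<rightarrow>\<^sub>E UNIV. dec \<pi> {} (b(i := y), 0) = (\<lambda>k. x0 i k + u k)}" for u
  have G_sets: "G u \<in> sets ?N" for u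
    unfolding N G_def by auto
  have le: "measure (secrets \<pi>) ?E \<le> measure (transcript_law \<pi> A x0) (G u)"
    if u: "u \<in> aggregate A ` user_data d A" for u
  proof -
    obtain x where x: "x \<in> user_data d A" "u = aggregate A x" using u by blast
    let ?x = "x(i := x0 i)"
    have x': "?x \<in> user_data d {1..n}"
      using x(1) x0 i A by (auto simp: PiE_iff extensional_def)
    have sum: "aggregate {1..n} ?x = (\<lambda>k. x0 i k + u k)"
      unfolding aggregate_def A(4)[symmetric] x(2) using A(2,3) by (auto simp: fun_eq_iff intro!: sum.cong)
    let ?F = "(\<lambda>\<theta>. \<lambda>j\<in>A. enc \<pi> j (?x j) (\<theta> j)) -` G u \<inter> space (secrets \<pi>)"
    have "measure (secrets \<pi>) ?E \<le> measure (secrets \<pi>) ?F"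
    proof (rule Q.finite_measure_mono_AE)
      show "?F \<in> Q.events" by (rule measurable_sets[OF meas[OF x'] G_sets])
      show "AE \<theta> in secrets \<pi>. \<theta> \<in> ?E \<longrightarrow> \<theta> \<in> ?F"
        using AE_secrets_correct[OF \<pi> corr x']
      proof eventually_elim
        fix \<theta> assume dec: "dec \<pi> {} (\<lambda>j\<in>{1..n}. enc \<pi> j (?x j) (\<theta> j), 0) = aggregate {1..n} ?x"
        show "\<theta> \<in> ?E \<longrightarrow> \<theta> \<in> ?F"
        proof
          assume \<theta>: "\<theta> \<in> ?E"
          then have "(\<lambda>j\<in>A. enc \<pi> j (?x j) (\<theta> j))(i := y) = (\<lambda>j\<in>{1..n}. enc \<pi> j (?x j) (\<theta> j))"
            unfolding A(4)[symmetric] by (auto simp: fun_eq_iff)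
          then show "\<theta> \<in> ?F"
            using dec[unfolded sum] \<theta> by (auto simp: G_def simp del: One_nat_def)
        qed
      qed
    qed
    also have "\<dots> = measure (transcript_law \<pi> A ?x) (G u)"
      unfolding transcript_law_def by (rule measure_distr[OF meas[OF x'] G_sets, symmetric])
    also have "transcript_law \<pi> A ?x = transcript_law \<pi> A x0"
      using i unfolding A_def by (intro transcript_law_const[OF \<pi> sec _ _ _ x0, of _ i] x'[unfolded A_def]) auto
    finally show ?thesis .
  qed
  have "measure (secrets \<pi>) ?E * real (card (aggregate A ` user_data d A))
      = (\<Sum>u\<in>aggregate A ` user_data d A. measure (secrets \<pi>) ?E)" by simp
  also have "\<dots> \<le> (\<Sum>u\<in>aggregate A ` user_data d A. measure (transcript_law \<pi> A x0) (G u))"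
    by (rule sum_mono) (rule le)
  also have "\<dots> = measure (transcript_law \<pi> A x0) (\<Union>u\<in>aggregate A ` user_data d A. G u)"
  proof (rule r.finite_measure_finite_Union[symmetric])
    show "finite (aggregate A ` user_data d A)"
      using finite_user_data[OF A(2), of d] by simp
    show "G ` aggregate A ` user_data d A \<subseteq> r.events"
      using G_sets by (auto simp: transcript_law_def)
    show "disjoint_family_on G (aggregate A ` user_data d A)"
      by (auto simp: disjoint_family_on_def G_def fun_eq_iff)
  qed
  also have "\<dots> \<le> 1" by (rule r.prob_le_1)
  finally show ?thesis .
qed

lemma finite_channel_message:
  assumes \<pi>: "aggregation_protocol n d \<pi>" and P: "P \<in> data_laws n d" and i: "i \<in> {1..n}"
  shows "finite_channel P (secrets \<pi>) (user_data d {1..n}) (count_space UNIV) (message \<pi> i)"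
proof -
  have "prob_space P" "sets P = Pow (user_data d {1..n})" "prob_space (secrets \<pi>)"
    using \<pi> P by (auto simp: aggregation_protocol_def data_laws_def prob_algebra_iff)
  moreover have "message \<pi> i \<in> P \<Otimes>\<^sub>M secrets \<pi> \<rightarrow>\<^sub>M count_space UNIV"
    using message_measurable[OF assms] by (simp add: joint_law_def)
  ultimately show ?thesis
    by (simp add: finite_channel_def finite_channel_axioms_def finite_user_data)
qed

lemma communication_cost_ge_aggregates:
  assumes \<pi>: "secure_histogram_protocol n d D \<pi>" and i: "i \<in> {1..n}" and d: "d \<ge> 1"
  defines "A \<equiv> {1..n} - {i}"
  shows "ennreal (log 2 (real (card (aggregate A ` user_data d A)))) \<le> communication_cost n d \<pi> i"
proof -
  let ?K = "real (card (aggregate A ` user_data d A))"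
  have prot: "aggregation_protocol n d \<pi>" and sec: "secure_given_sum n d \<pi>" and corr: "correct n d D \<pi>"
    using \<pi> by (auto simp: secure_histogram_protocol_def)
  define x0 where "x0 = (\<lambda>j\<in>{1..n}. unit_vector 1)"
  have x0: "x0 \<in> user_data d {1..n}" unfolding x0_def one_hot_def using d by auto
  then have "restrict x0 A \<in> user_data d A" unfolding A_def by auto
  then have K: "1 \<le> ?K"
    using finite_user_data[of A d] unfolding A_def
    by (metis One_nat_def Suc_leI card_gt_0_iff empty_iff finite_Diff finite_atLeastAtMost finite_imageI
        image_is_empty of_nat_1 of_nat_mono)
  define P where "P = data_law n d (return_pmf x0)"
  have P: "P \<in> data_laws n d"
    unfolding P_def using x0 by (intro data_law_in) simp
  interpret finite_channel P "secrets \<pi>" "user_data d {1..n}" "count_space UNIV" "message \<pi> i"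
    by (rule finite_channel_message[OF prot P i])
  have atom: "emeasure (kernel x) {y} \<le> ennreal (1 / ?K)" if x: "x \<in> user_data d {1..n}" for x y
  proof -
    have "emeasure (kernel x) {y} = emeasure (secrets \<pi>) {\<theta> \<in> space (secrets \<pi>). enc \<pi> i (x i) (\<theta> i) = y}"
      unfolding kernel_def
      by (subst emeasure_distr[OF V_Pair[OF x]])
        (auto simp: message_def intro!: arg_cong2[where f = emeasure])
    also have "\<dots> \<le> ennreal (1 / ?K)"
      unfolding Q.emeasure_eq_measure
      using message_atom_le[OF prot sec corr i x, of y] K unfolding A_def
      by (intro ennreal_leI) (simp add: field_simps)
    finally show ?thesis .
  qed
  have "J.prob (message \<pi> i -` {y} \<inter> space (P \<Otimes>\<^sub>M secrets \<pi>)) \<le> 1 / ?K" for y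
  proof -
    have "emeasure (P \<Otimes>\<^sub>M secrets \<pi>) (message \<pi> i -` {y} \<inter> space (P \<Otimes>\<^sub>M secrets \<pi>)) = emeasure marginal {y}"
      unfolding marginal_def by (rule emeasure_distr[symmetric]) simp_all
    also have "\<dots> = (\<integral>\<^sup>+x. emeasure (kernel x) {y} \<partial>P)"
      by (rule emeasure_marginal) simp
    also have "\<dots> \<le> (\<integral>\<^sup>+x. ennreal (1 / ?K) \<partial>P)"
      by (intro nn_integral_mono) (simp add: space_P atom)
    also have "\<dots> = ennreal (1 / ?K)" by (simp add: P.emeasure_space_1)
    finally show ?thesis using K by (simp add: J.P.emeasure_eq_measure)
  qed
  then have "ennreal (log 2 ?K) \<le> entropy_bits (P \<Otimes>\<^sub>M secrets \<pi>) (message \<pi> i)"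
    by (intro J.P.min_entropy_le_entropy_bits[OF V K])
  also have "\<dots> \<le> communication_cost n d \<pi> i"
    unfolding communication_cost_def joint_law_def using P by (rule SUP_upper)
  finally show ?thesis .
qed

text \<open>With a single user the sum is the data itself.\<close>

lemma communication_cost_ge_single:
  assumes \<pi>: "secure_histogram_protocol 1 d D \<pi>" and d: "d \<ge> 1"
  shows "ennreal (log 2 (real d)) \<le> communication_cost 1 d \<pi> 1"
proof -
  have prot: "aggregation_protocol 1 d \<pi>" and corr: "correct 1 d D \<pi>"
    using \<pi> by (auto simp: secure_histogram_protocol_def)
  let ?U = "user_data d {1..1}"
  have card: "card ?U = d" by (simp add: card_PiE card_one_hot)
  have fin: "finite ?U" by (simp add: finite_user_data)
  have ne: "?U \<noteq> {}" using card d by force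
  define P where "P = data_law 1 d (pmf_of_set ?U)"
  have P: "P \<in> data_laws 1 d"
    unfolding P_def using fin ne by (intro data_law_in) (simp only: set_pmf_of_set[OF ne fin] subset_refl)
  interpret finite_channel P "secrets \<pi>" ?U "count_space UNIV" "message \<pi> 1"
    by (rule finite_channel_message[OF prot P]) simp
  have "J.prob (message \<pi> 1 -` {y} \<inter> space (P \<Otimes>\<^sub>M secrets \<pi>)) \<le> 1 / real d" for y
  proof -
    let ?w = "dec \<pi> {} (\<lambda>i\<in>{1..1}. y, 0)"
    define B where "B = {x \<in> ?U. x 1 = ?w}"
    have B: "B \<subseteq> {\<lambda>i\<in>{1..1}. ?w}"
      unfolding B_def by (auto simp: PiE_iff extensional_def fun_eq_iff)
    have BU: "B \<subseteq> ?U" by (auto simp: B_def)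
    then have B_sets: "B \<in> sets P" by (simp add: sets_P)
    have "AE \<omega> in P \<Otimes>\<^sub>M secrets \<pi>. dec \<pi> {} (view 1 \<pi> {} \<omega>) = surviving_sum 1 {} \<omega>"
      using corr[unfolded correct_def joint_law_def, rule_format, OF P, of "{}"] by simp
    then have "AE \<omega> in P \<Otimes>\<^sub>M secrets \<pi>. \<omega> \<in> message \<pi> 1 -` {y} \<inter> space (P \<Otimes>\<^sub>M secrets \<pi>) \<longrightarrow> \<omega> \<in> B \<times> space (secrets \<pi>)"
    proof eventually_elim
      fix \<omega> assume dec: "dec \<pi> {} (view 1 \<pi> {} \<omega>) = surviving_sum 1 {} \<omega>"
      show "\<omega> \<in> message \<pi> 1 -` {y} \<inter> space (P \<Otimes>\<^sub>M secrets \<pi>) \<longrightarrow> \<omega> \<in> B \<times> space (secrets \<pi>)"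
      proof
        assume \<omega>: "\<omega> \<in> message \<pi> 1 -` {y} \<inter> space (P \<Otimes>\<^sub>M secrets \<pi>)"
        then have "view 1 \<pi> {} \<omega> = (\<lambda>i\<in>{1..1}. y, 0)"
          by (auto simp: view_def fun_eq_iff)
        then have "fst \<omega> 1 = ?w"
          using dec by (simp add: aggregate_def)
        then show "\<omega> \<in> B \<times> space (secrets \<pi>)"
          using \<omega> by (cases \<omega>) (auto simp: B_def space_pair_measure space_P)
      qed
    qed
    then have "emeasure (P \<Otimes>\<^sub>M secrets \<pi>) (message \<pi> 1 -` {y} \<inter> space (P \<Otimes>\<^sub>M secrets \<pi>))
        \<le> emeasure (P \<Otimes>\<^sub>M secrets \<pi>) (B \<times> space (secrets \<pi>))"
      using B_sets by (intro emeasure_mono_AE) auto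
    also have "\<dots> = emeasure P B"
      using B_sets by (simp add: Q.emeasure_pair_measure_Times Q.emeasure_space_1)
    also have "\<dots> = emeasure (measure_pmf (pmf_of_set ?U)) B"
      unfolding P_def using BU by (rule emeasure_data_law)
    also have "\<dots> = ennreal (real (card (?U \<inter> B)) / real (card ?U))"
      by (rule emeasure_pmf_of_set[OF ne fin])
    also have "\<dots> \<le> ennreal (1 / real d)"
    proof -
      have "card (?U \<inter> B) \<le> card {\<lambda>i\<in>{1..1::nat}. ?w}"
        using B by (intro card_mono) auto
      then show ?thesis unfolding card by (intro ennreal_leI divide_right_mono) auto
    qed
    finally show ?thesis by (simp add: J.P.emeasure_eq_measure)
  qed
  then have "ennreal (log 2 (real d)) \<le> entropy_bits (P \<Otimes>\<^sub>M secrets \<pi>) (message \<pi> 1)"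
    using d by (intro J.P.min_entropy_le_entropy_bits[OF V]) auto
  also have "\<dots> \<le> communication_cost 1 d \<pi> 1"
    unfolding communication_cost_def joint_law_def using P by (rule SUP_upper)
  finally show ?thesis .
qed

lemma communication_cost_ge:
  fixes \<epsilon> :: real
  assumes \<pi>: "secure_histogram_protocol n d D \<pi>" and i: "i \<in> {1..n}"
    and d: "d \<ge> 2" and "\<epsilon> > 0" and regime: "real d \<ge> real n powr (1 + \<epsilon>)"
  shows "ennreal (\<epsilon> / (2 * (1 + \<epsilon>)) * real n * log 2 (real d)) \<le> communication_cost n d \<pi> i"
proof -
  let ?c = "\<epsilon> / (2 * (1 + \<epsilon>))" and ?L = "log 2 (real d)"
  have L: "0 \<le> ?L" using d by simp
  show ?thesis
  proof (cases "n = 1")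
    case True
    have "?c \<le> 1" using \<open>\<epsilon> > 0\<close> by (simp add: field_simps)
    then have "?c * real n * ?L \<le> ?L"
      using True mult_right_mono[OF _ L, of ?c 1] by simp
    then show ?thesis
      using communication_cost_ge_single[of d D \<pi>] \<pi> i d True
      by (auto intro: order_trans[OF ennreal_leI])
  next
    case False
    define A where "A = {1..n} - {i}"
    define r where "r = n - 1"
    have r: "card A = r" "1 \<le> r" "real n = real r + 1"
      using False i unfolding A_def r_def by auto
    define K where "K = card (aggregate A ` user_data d A)"
    have count: "d ^ r \<le> K * r ^ r"
      using card_user_data_le_aggregates[of A d] r unfolding K_def A_def by simp
    have "0 < K"
      using count d by (cases "K = 0") auto
    have "(1 + \<epsilon>) * log 2 (real n) = log 2 (real n powr (1 + \<epsilon>))"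
      using i by (simp add: log_powr)
    also have "\<dots> \<le> ?L"
      using regime i d by simp
    finally have "(1 + \<epsilon>) * log 2 (real n) \<le> ?L" .
    moreover have "log 2 (real r) \<le> log 2 (real n)" using r by simp
    ultimately have log_r: "log 2 (real r) \<le> ?L / (1 + \<epsilon>)"
      using \<open>\<epsilon> > 0\<close> by (simp add: field_simps) (smt (verit) mult_left_mono)
    have "real d ^ r \<le> real K * real r ^ r"
      using of_nat_mono[OF count, where 'a = real] by simp
    then have "log 2 (real d ^ r) \<le> log 2 (real K * real r ^ r)"
      using d \<open>0 < K\<close> r by (subst log_le_cancel_iff) auto
    then have "real r * ?L \<le> log 2 (real K) + real r * log 2 (real r)"
      using d \<open>0 < K\<close> r by (simp add: log_mult log_nat_power)
    also have "\<dots> \<le> log 2 (real K) + real r * (?L / (1 + \<epsilon>))"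
      using log_r by (intro add_left_mono mult_left_mono) auto
    finally have "real r * (?L - ?L / (1 + \<epsilon>)) \<le> log 2 (real K)"
      by (simp add: algebra_simps)
    moreover have "?L - ?L / (1 + \<epsilon>) = 2 * ?c * ?L"
      using \<open>\<epsilon> > 0\<close> by (simp add: field_simps)
    ultimately have "2 * real r * (?c * ?L) \<le> log 2 (real K)"
      by (simp add: algebra_simps)
    moreover have "real n * (?c * ?L) \<le> 2 * real r * (?c * ?L)"
      using r L \<open>\<epsilon> > 0\<close> by (intro mult_right_mono) auto
    ultimately have "?c * real n * ?L \<le> log 2 (real K)"
      by (simp add: mult_ac)
    then have "ennreal (?c * real n * ?L) \<le> ennreal (log 2 (real K))" by (rule ennreal_leI)
    also have "\<dots> \<le> communication_cost n d \<pi> i"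
      unfolding K_def A_def using \<pi> i d by (intro communication_cost_ge_aggregates) auto
    finally show ?thesis .
  qed
qed

theorem theorem4p1:
  shows "\<forall>\<epsilon>::real. \<epsilon> > 0 \<longrightarrow> (\<exists>c C :: real. c > 0 \<and> C > 0 \<and>
    (\<forall>n d D :: nat. n \<ge> 1 \<and> d \<ge> 2 \<and> real d \<ge> real n powr (1 + \<epsilon>) \<and> D \<le> n \<longrightarrow>
      (\<exists>\<pi>. secure_histogram_protocol n d D \<pi> \<and>
        (\<forall>i\<in>{1..n}. communication_cost n d \<pi> i \<le> ennreal (C * real n * log 2 (real d)))) \<and>
      (\<forall>\<pi>. secure_histogram_protocol n d D \<pi> \<longrightarrow>
        (\<forall>i\<in>{1..n}. communication_cost n d \<pi> i \<ge> ennreal (c * real n * log 2 (real d))))))"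
proof (intro allI impI)
  fix \<epsilon> :: real assume \<epsilon>: "\<epsilon> > 0"
  have n_le_d: "n \<le> d" if "n \<ge> 1" "real d \<ge> real n powr (1 + \<epsilon>)" for n d :: nat
  proof -
    have "real n = real n powr 1" using that by simp
    also have "\<dots> \<le> real n powr (1 + \<epsilon>)" using that \<epsilon> by (intro powr_mono) auto
    finally show ?thesis using that by simp
  qed
  show "\<exists>c C :: real. c > 0 \<and> C > 0 \<and>
    (\<forall>n d D :: nat. n \<ge> 1 \<and> d \<ge> 2 \<and> real d \<ge> real n powr (1 + \<epsilon>) \<and> D \<le> n \<longrightarrow>
      (\<exists>\<pi>. secure_histogram_protocol n d D \<pi> \<and>
        (\<forall>i\<in>{1..n}. communication_cost n d \<pi> i \<le> ennreal (C * real n * log 2 (real d)))) \<and>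
      (\<forall>\<pi>. secure_histogram_protocol n d D \<pi> \<longrightarrow>
        (\<forall>i\<in>{1..n}. communication_cost n d \<pi> i \<ge> ennreal (c * real n * log 2 (real d)))))"
  proof (rule exI[of _ "\<epsilon> / (2 * (1 + \<epsilon>))"], rule exI[of _ "6 :: real"], intro conjI allI impI ballI)
    show "0 < \<epsilon> / (2 * (1 + \<epsilon>))" "0 < (6 :: real)" using \<epsilon> by simp_all
  next
    fix n d D :: nat
    assume "n \<ge> 1 \<and> d \<ge> 2 \<and> real d \<ge> real n powr (1 + \<epsilon>) \<and> D \<le> n"
    then show "\<exists>\<pi>. secure_histogram_protocol n d D \<pi> \<and>
        (\<forall>i\<in>{1..n}. communication_cost n d \<pi> i \<le> ennreal (6 * real n * log 2 (real d)))"
      using n_le_d by (intro secure_histogram_protocol_exists) auto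
  next
    fix n d D :: nat and \<pi> i
    assume "n \<ge> 1 \<and> d \<ge> 2 \<and> real d \<ge> real n powr (1 + \<epsilon>) \<and> D \<le> n"
      "secure_histogram_protocol n d D \<pi>" "i \<in> {1..n}"
    then show "communication_cost n d \<pi> i \<ge> ennreal (\<epsilon> / (2 * (1 + \<epsilon>)) * real n * log 2 (real d))"
      using \<epsilon> by (intro communication_cost_ge[where D = D]) auto
  qed
qed

end
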